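(* Let $q$ be a prime power, let $\mathcal X$ be a class of $q$-matroids (over $\mathbb F_q$) that is closed under contraction, and let $u,r,n\in\mathbb N$ be such that $0\leq u\leq r\leq n$. Then $$\frac{\log(x(r,n)+1)}{\begin{bmatrix} n \\ r \end{bmatrix}_q}\leq \frac{\log(x(r-u,n-u)+1)}{\begin{bmatrix} n-u \\ r-u \end{bmatrix}_q}.$$
   Context: $\begin{bmatrix} n\\ k\end{bmatrix}_q$ is the Gaussian binomial coefficient, i.e. the number of $k$-dimensional subspaces of $\mathbb F_q^n$. The logarithm is to any fixed base greater than $1$. Here $0\in\mathbb N$. For a finite-dimensional vector space $E$ over $\mathbb F_q$, let $\mathcal L(E)$ denote the set of all linear subspaces of $E$. A $q$-matroid is a pair $M=(E,\rho)$ with $\rho:\mathcal L(E)\to\mathbb Z_{\ge 0}$ such that for all $V,W\in\mathcal L(E)$: (R1) $0\le\rho(V)\le\dim V$; (R2) $V\le W$ implies $\rho(V)\le\rho(W)$; (R3) $\rho(V+W)+\rho(V\cap W)\le\rho(V)+\rho(W)$. $E=E(M)$ is the ground space and $\rho(M):=\rho(E)$ the rank of $M$. For $T\le E$, the contraction of $M$ by $T$ is the $q$-matroid $M/T=(E/T,\rho_{M/T})$ with $\rho_{M/T}(A/T)=\rho(A)-\rho(T)$ for all $T\le A\le E$. For a vector space isomorphism $\phi:E\to F$, $\phi(M)$ is the $q$-matroid $(F,\rho\circ\phi^{-1})$, i.e. the rank of $V\le F$ in $\phi(M)$ is $\rho(\phi^{-1}(V))$. For a class $\mathcal X$ of $q$-matroids,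 put $\mathcal X(n):=\{M\in\mathcal X: E(M)=\mathbb F_q^n\}$, $\mathcal X(r,n):=\{M\in\mathcal X(n):\rho(M)=r\}$ and $x(r,n):=|\mathcal X(r,n)|$ (equality of $q$-matroids, not isomorphism). The class $\mathcal X$ is closed under contraction if for all $u,n\in\mathbb N$ with $0\le u\le n$ and each subspace $U\le\mathbb F_q^n$ of dimension $u$, there exists a vector space isomorphism $\phi:\mathbb F_q^n/U\to\mathbb F_q^{n-u}$ such that $\phi(M/U)\in\mathcal X(n-u)$ for all $M\in\mathcal X(n)$. *)

theory Defs
  imports "HOL-Algebra.AbelCoset" "Jordan_Normal_Form.VS_Connect"
begin

definition subspaces :: "('k, 'm) ring_scheme \<Rightarrow> ('k, 'v) module \<Rightarrow> 'v set set" where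
  "subspaces K E = {W. VectorSpace.subspace K W E}"

definition subspace_dim :: "('k, 'm) ring_scheme \<Rightarrow> ('k, 'v) module \<Rightarrow> 'v set \<Rightarrow> nat" where
  "subspace_dim K E W = vectorspace.dim K (E\<lparr>carrier := W\<rparr>)"

text \<open>A rank function is only meaningful on subspaces. Requiring it to be extensional makes
  equality of pairs coincide with equality of q-matroids.\<close>

type_synonym ('k, 'v) qmat = "('k, 'v) module \<times> ('v set \<Rightarrow> nat)"

locale q_matroid = vectorspace K E
  for K :: "('k, 'm) ring_scheme" and E :: "('k, 'v) module" +
  fixes \<rho> :: "'v set \<Rightarrow> nat"
  assumes finite_field: "finite (carrier K)"
    and finite_dimensional: fin_dim
    and extensional: "\<rho> \<in> extensional (subspaces K E)"
    and rank_le_dim: "V \<in> subspaces K E \<Longrightarrow> \<rho> V \<le> subspace_dim K E V"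
    and rank_mono: "\<lbrakk>V \<in> subspaces K E; W \<in> subspaces K E; V \<subseteq> W\<rbrakk> \<Longrightarrow> \<rho> V \<le> \<rho> W"
    and rank_submodular: "\<lbrakk>V \<in> subspaces K E; W \<in> subspaces K E\<rbrakk>
      \<Longrightarrow> \<rho> (subspace_sum V W) + \<rho> (V \<inter> W) \<le> \<rho> V + \<rho> W"

text \<open>The quotient space \<open>E/T\<close> of cosets. The scalar multiple of a coset is a union of equal cosets,
  which also covers the scalar 0. The ring fields \<open>mult\<close> and \<open>one\<close> of a module record are junk.\<close>

definition quotient_space :: "('k, 'v, 'x) module_scheme \<Rightarrow> 'v set \<Rightarrow> ('k, 'v set) module" where
  "quotient_space E T = \<lparr>
     carrier = a_rcosets\<^bsub>E\<^esub> T,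
     mult = undefined,
     one = undefined,
     zero = T,
     add = (<+>\<^bsub>E\<^esub>),
     smult = (\<lambda>c X. \<Union>x\<in>X. T +>\<^bsub>E\<^esub> (c \<odot>\<^bsub>E\<^esub> x))\<rparr>"

definition quotient_subspace :: "('k, 'v) module \<Rightarrow> 'v set \<Rightarrow> 'v set \<Rightarrow> 'v set set" where
  "quotient_subspace E A T = (\<lambda>a. T +>\<^bsub>E\<^esub> a) ` A"

context vectorspace
begin

lemma subspace_abelian_subgroup:
  assumes "VectorSpace.subspace K T V"
  shows "abelian_subgroup T V"
proof (rule abelian_subgroupI3[OF additive_subgroup.intro])
  have sm: "submodule K T V" using assms by (simp add: VectorSpace.subspace_def)
  then interpret md: Module.module K "V\<lparr>carrier := T\<rparr>" by (rule submodule_is_module)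
  show "subgroup T (add_monoid V)"
  proof (rule add.subgroupI)
    show "T \<subseteq> carrier V" "T \<noteq> {}" using sm by (auto simp: submodule_def)
    show "a \<oplus>\<^bsub>V\<^esub> b \<in> T" if "a \<in> T" "b \<in> T" for a b
      using sm that by (auto simp: submodule_def)
    show "\<ominus>\<^bsub>V\<^esub> a \<in> T" if "a \<in> T" for a
    proof -
      have aV: "a \<in> carrier V" using sm that by (auto simp: submodule_def)
      have "(\<ominus>\<^bsub>K\<^esub> \<one>\<^bsub>K\<^esub>) \<odot>\<^bsub>V\<^esub> a \<in> T" using sm that by (auto simp: submodule_def)
      then show ?thesis using aV by (simp add: smult_l_minus)
    qed
  qed
  show "abelian_group V" by (rule abelian_group_axioms)
qed

lemma smult_a_r_coset:
  assumes T: "VectorSpace.subspace K T V" and c: "c \<in> carrier K" and x: "x \<in> carrier V"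
  shows "(\<Union>y\<in>T +>\<^bsub>V\<^esub> x. T +>\<^bsub>V\<^esub> (c \<odot>\<^bsub>V\<^esub> y)) = T +>\<^bsub>V\<^esub> (c \<odot>\<^bsub>V\<^esub> x)"
proof -
  interpret T: abelian_subgroup T V by (rule subspace_abelian_subgroup[OF T])
  have *: "T +>\<^bsub>V\<^esub> (c \<odot>\<^bsub>V\<^esub> y) = T +>\<^bsub>V\<^esub> (c \<odot>\<^bsub>V\<^esub> x)" if "y \<in> T +>\<^bsub>V\<^esub> x" for y
  proof -
    from that obtain t where t: "t \<in> T" "y = t \<oplus>\<^bsub>V\<^esub> x" by (auto simp: a_r_coset_def')
    have tV: "t \<in> carrier V" using t(1) T.a_subset by auto
    have "c \<odot>\<^bsub>V\<^esub> y = c \<odot>\<^bsub>V\<^esub> t \<oplus>\<^bsub>V\<^esub> c \<odot>\<^bsub>V\<^esub> x"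
      using t(2) tV c x by (simp add: smult_r_distr)
    moreover have "c \<odot>\<^bsub>V\<^esub> t \<in> T"
      using T t(1) c by (auto simp: VectorSpace.subspace_def submodule_def)
    ultimately have "c \<odot>\<^bsub>V\<^esub> y \<in> T +>\<^bsub>V\<^esub> (c \<odot>\<^bsub>V\<^esub> x)" by (auto simp: a_r_coset_def')
    then show ?thesis using T.a_repr_independence' c x by (metis smult_closed)
  qed
  have "x \<in> T +>\<^bsub>V\<^esub> x" by (rule T.a_rcos_self[OF x])
  with * show ?thesis by blast
qed

lemma quotient_space_smult:
  assumes "VectorSpace.subspace K T V" "c \<in> carrier K" "x \<in> carrier V"
  shows "c \<odot>\<^bsub>quotient_space V T\<^esub> (T +>\<^bsub>V\<^esub> x) = T +>\<^bsub>V\<^esub> (c \<odot>\<^bsub>V\<^esub> x)"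
  using smult_a_r_coset[OF assms] by (simp add: quotient_space_def)

lemma quotient_space_vectorspace:
  assumes T: "VectorSpace.subspace K T V"
  shows "vectorspace K (quotient_space V T)"
proof -
  interpret T: abelian_subgroup T V by (rule subspace_abelian_subgroup[OF T])
  let ?Q = "quotient_space V T"
  have carr: "carrier ?Q = (\<lambda>x. T +>\<^bsub>V\<^esub> x) ` carrier V"
    by (auto simp: quotient_space_def A_RCOSETS_def')
  have add: "(T +>\<^bsub>V\<^esub> x) \<oplus>\<^bsub>?Q\<^esub> (T +>\<^bsub>V\<^esub> y) = T +>\<^bsub>V\<^esub> (x \<oplus>\<^bsub>V\<^esub> y)"
    if "x \<in> carrier V" "y \<in> carrier V" for x y
    using T.a_rcos_sum[OF that] by (simp add: quotient_space_def)
  have zero: "\<zero>\<^bsub>?Q\<^esub> = T +>\<^bsub>V\<^esub> \<zero>\<^bsub>V\<^esub>"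
    using M.a_coset_join2[OF _ T.a_subgroup] by (simp add: quotient_space_def)
  note smult = quotient_space_smult[OF T]
  have neg: "\<exists>y\<in>carrier V. (T +>\<^bsub>V\<^esub> x) \<oplus>\<^bsub>?Q\<^esub> (T +>\<^bsub>V\<^esub> y) = \<zero>\<^bsub>?Q\<^esub>" if "x \<in> carrier V" for x
    using that by (intro bexI[of _ "\<ominus>\<^bsub>V\<^esub> x"]) (auto simp: add zero M.r_neg)
  show ?thesis
  proof (rule vs_criteria)
    show "field K" ..
    show "\<forall>v\<in>carrier ?Q. \<exists>neg_v\<in>carrier ?Q. v \<oplus>\<^bsub>?Q\<^esub> neg_v = \<zero>\<^bsub>?Q\<^esub>"
      using neg by (auto simp: carr)
  qed (auto simp: carr add zero smult smult_l_distr smult_r_distr smult_assoc1 M.a_ac)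
qed

end

text \<open>A subspace \<open>B\<close> of \<open>E/T\<close> equals \<open>A/T\<close> for \<open>A = \<Union>B\<close>; see \<open>contraction_rank\<close>.
  The subtraction does not truncate, because \<open>T \<subseteq> A\<close>.\<close>

definition contraction :: "('k, 'm) ring_scheme \<Rightarrow> ('k, 'v) qmat \<Rightarrow> 'v set \<Rightarrow> ('k, 'v set) qmat" where
  "contraction K M T = (case M of (E, \<rho>) \<Rightarrow>
     (quotient_space E T, \<lambda>B\<in>subspaces K (quotient_space E T). \<rho> (\<Union>B) - \<rho> T))"

lemma contraction_rank:
  assumes M: "q_matroid K E \<rho>"
    and T: "T \<in> subspaces K E" and A: "A \<in> subspaces K E" and TA: "T \<subseteq> A"
  shows "quotient_subspace E A T \<in> subspaces K (quotient_space E T)"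
    and "\<Union>(quotient_subspace E A T) = A"
    and "snd (contraction K (E, \<rho>) T) (quotient_subspace E A T) = \<rho> A - \<rho> T"
    and "\<rho> T \<le> \<rho> A"
proof -
  interpret q_matroid K E \<rho> by (rule M)
  have T': "VectorSpace.subspace K T E" and A': "VectorSpace.subspace K A E"
    using T A by (auto simp: subspaces_def)
  interpret T: abelian_subgroup T E by (rule subspace_abelian_subgroup[OF T'])
  interpret Q: vectorspace K "quotient_space E T" by (rule quotient_space_vectorspace[OF T'])
  have sm: "A \<subseteq> carrier E" "\<zero>\<^bsub>E\<^esub> \<in> A" "\<And>v w. v \<in> A \<Longrightarrow> w \<in> A \<Longrightarrow> v \<oplus>\<^bsub>E\<^esub> w \<in> A"
    "\<And>c v. c \<in> carrier K \<Longrightarrow> v \<in> A \<Longrightarrow> c \<odot>\<^bsub>E\<^esub> v \<in> A"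
    using A' by (auto simp: VectorSpace.subspace_def submodule_def)
  let ?Q = "quotient_space E T" and ?B = "quotient_subspace E A T"
  have add: "(T +>\<^bsub>E\<^esub> x) \<oplus>\<^bsub>?Q\<^esub> (T +>\<^bsub>E\<^esub> y) = T +>\<^bsub>E\<^esub> (x \<oplus>\<^bsub>E\<^esub> y)"
    if "x \<in> A" "y \<in> A" for x y
    using T.a_rcos_sum[of x y] that sm(1) by (auto simp: quotient_space_def)
  have zero: "\<zero>\<^bsub>?Q\<^esub> = T +>\<^bsub>E\<^esub> \<zero>\<^bsub>E\<^esub>"
    using M.a_coset_join2[OF _ T.a_subgroup] by (simp add: quotient_space_def)
  have "submodule K ?B ?Q"
  proof (rule submodule.intro)
    show "Module.module K ?Q" by (rule Q.module_axioms)
    show "?B \<subseteq> carrier ?Q"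
      using sm(1) by (auto simp: quotient_subspace_def quotient_space_def A_RCOSETS_def')
    show "\<zero>\<^bsub>?Q\<^esub> \<in> ?B" using sm(2) by (auto simp: zero quotient_subspace_def)
    show "v \<oplus>\<^bsub>?Q\<^esub> w \<in> ?B" if "v \<in> ?B" "w \<in> ?B" for v w
      using that sm(3) by (auto simp: quotient_subspace_def add)
    show "c \<odot>\<^bsub>?Q\<^esub> v \<in> ?B" if c: "c \<in> carrier K" and v: "v \<in> ?B" for c v
    proof -
      from v obtain x where x: "x \<in> A" "v = T +>\<^bsub>E\<^esub> x" by (auto simp: quotient_subspace_def)
      then have "c \<odot>\<^bsub>?Q\<^esub> v = T +>\<^bsub>E\<^esub> (c \<odot>\<^bsub>E\<^esub> x)"
        using quotient_space_smult[OF T' c] sm(1) by blast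
      then show ?thesis using sm(4)[OF c x(1)] by (auto simp: quotient_subspace_def)
    qed
  qed
  then show B: "?B \<in> subspaces K ?Q"
    using Q.vectorspace_axioms by (simp add: subspaces_def VectorSpace.subspace_def)
  have "T +>\<^bsub>E\<^esub> a \<subseteq> A" if "a \<in> A" for a
    using that TA sm(3) by (auto simp: a_r_coset_def')
  moreover have "a \<in> T +>\<^bsub>E\<^esub> a" if "a \<in> A" for a
    using T.a_rcos_self that sm(1) by blast
  ultimately show U: "\<Union>?B = A" by (auto simp: quotient_subspace_def)
  show "snd (contraction K (E, \<rho>) T) ?B = \<rho> A - \<rho> T"
    using B U by (simp add: contraction_def)
  show "\<rho> T \<le> \<rho> A" by (rule rank_mono[OF T A TA])
qed

definition vs_isomorphism ::
    "('k, 'm) ring_scheme \<Rightarrow> ('k, 'v) module \<Rightarrow> ('k, 'w) module \<Rightarrow> ('v \<Rightarrow> 'w) \<Rightarrow> bool" where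
  "vs_isomorphism K E F \<phi> \<longleftrightarrow> linear_map K E F \<phi> \<and> bij_betw \<phi> (carrier E) (carrier F)"

definition q_matroid_image ::
    "('k, 'm) ring_scheme \<Rightarrow> ('v \<Rightarrow> 'w) \<Rightarrow> ('k, 'w) module \<Rightarrow> ('k, 'v) qmat \<Rightarrow> ('k, 'w) qmat" where
  "q_matroid_image K \<phi> F M = (case M of (E, \<rho>) \<Rightarrow>
     (F, \<lambda>V\<in>subspaces K F. \<rho> (\<phi> -` V \<inter> carrier E)))"

text \<open>From here on, \<open>\<bbbF>\<^sub>q\<close> is a finite field type \<open>'a\<close> with \<open>q = CARD('a)\<close> elements, and
  \<open>\<bbbF>\<^sub>q\<^sup>n\<close> is \<open>module_vec TYPE('a) n\<close>.\<close>

definition gaussian_binomial :: "'a::{field,finite} itself \<Rightarrow> nat \<Rightarrow> nat \<Rightarrow> nat" where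
  "gaussian_binomial ty n k =
     card {W \<in> subspaces class_ring (module_vec ty n). subspace_dim class_ring (module_vec ty n) W = k}"

definition class_of_q_matroids :: "('a::{field,finite}, 'a vec) qmat set \<Rightarrow> bool" where
  "class_of_q_matroids X \<longleftrightarrow> (\<forall>(E, \<rho>)\<in>X. q_matroid class_ring E \<rho>)"

definition members_on :: "('a::{field,finite}, 'a vec) qmat set \<Rightarrow> nat \<Rightarrow> ('a, 'a vec) qmat set" where
  "members_on X n = {M \<in> X. fst M = module_vec TYPE('a) n}"

definition members_of_rank ::
    "('a::{field,finite}, 'a vec) qmat set \<Rightarrow> nat \<Rightarrow> nat \<Rightarrow> ('a, 'a vec) qmat set" where
  "members_of_rank X r n = {(E, \<rho>) \<in> members_on X n. \<rho> (carrier E) = r}"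

definition closed_under_contraction :: "('a::{field,finite}, 'a vec) qmat set \<Rightarrow> bool" where
  "closed_under_contraction X \<longleftrightarrow>
     (\<forall>u n. \<forall>U \<in> subspaces class_ring (module_vec TYPE('a) n).
        u \<le> n \<longrightarrow> subspace_dim class_ring (module_vec TYPE('a) n) U = u \<longrightarrow>
        (\<exists>\<phi>. vs_isomorphism class_ring (quotient_space (module_vec TYPE('a) n) U)
               (module_vec TYPE('a) (n - u)) \<phi> \<and>
             (\<forall>M \<in> members_on X n.
                q_matroid_image class_ring \<phi> (module_vec TYPE('a) (n - u))
                  (contraction class_ring M U) \<in> members_on X (n - u))))"

end

theory Submission
  imports Defs "Jordan_Normal_Form.DL_Rank" "HOL-Library.Cardinality" "HOL-Analysis.Convex"
begin

text \<open>A \<open>q\<close>-matroid of rank \<open>r\<close> on \<open>\<bbbF>\<^sub>q\<^sup>n\<close> is determined by its nonempty set of bases, a family of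
  \<open>r\<close>-dimensional subspaces. Together with the empty family this gives \<open>x(r,n) + 1\<close> families, to which
  the counting version of Shearer's lemma is applied with the covering
  \<open>{W. U \<subseteq> W}\<close>, \<open>U\<close> ranging over the \<open>u\<close>-dimensional subspaces. The bases containing \<open>U\<close> are
  either absent (\<open>U\<close> is dependent) or are read off from the contraction by \<open>U\<close>, so each trace takes
  at most \<open>x(r-u,n-u) + 1\<close> values. Every \<open>r\<close>-dimensional subspace is covered the same number of times,
  and double counting pairs \<open>U \<subseteq> W\<close> turns the exponents into the quotients of the statement.\<close>

section \<open>Shearer's lemma\<close>

text \<open>Mahler's inequality, from AM-GM: with \<open>p\<close> the product of the
  \<open>a i + b i\<close> and \<open>k = card J\<close>, \<open>s\<close> is at most the
  \<open>k\<close>-th root of \<open>C * p\<close> times the mean of the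
  \<open>a i / (a i + b i)\<close>. The same holds for \<open>t\<close> with \<open>b\<close>, and
  the two means add up to 1. The constant \<open>C\<close> makes room for factors that are not
  split.\<close>

lemma mahler_prod_add_ge:
  fixes a b :: "'i \<Rightarrow> real" and s t C :: real
  assumes J: "finite J" "J \<noteq> {}"
    and nonneg: "\<And>i. i \<in> J \<Longrightarrow> a i \<ge> 0" "\<And>i. i \<in> J \<Longrightarrow> b i \<ge> 0" "s \<ge> 0" "t \<ge> 0" "C \<ge> 0"
    and s: "s ^ card J \<le> C * prod a J" and t: "t ^ card J \<le> C * prod b J"
  shows "(s + t) ^ card J \<le> C * (\<Prod>i\<in>J. a i + b i)"
proof (cases "\<exists>i\<in>J. a i + b i = 0")
  \<comment> \<open>Division by \<open>a i + b i\<close> is impossible here, but both products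
    vanish and force \<open>s = t = 0\<close>.\<close>
  case True
  then obtain i where i: "i \<in> J" "a i + b i = 0" by blast
  then have "a i = 0" "b i = 0" using nonneg(1,2)[OF i(1)] by auto
  then have "prod a J = 0" "prod b J = 0" "(\<Prod>i\<in>J. a i + b i) = 0"
    using i J(1) by (auto intro!: prod_zero bexI[of _ i])
  moreover have "card J > 0" using J by (simp add: card_gt_0_iff)
  ultimately have "s = 0" "t = 0"
    using s t nonneg(3,4) zero_le_power[OF nonneg(3), of "card J"] zero_le_power[OF nonneg(4), of "card J"]
    by (auto intro: order_antisym simp: le_less)
  with \<open>card J > 0\<close> \<open>(\<Prod>i\<in>J. a i + b i) = 0\<close> show ?thesis by (simp add: zero_power)
next
  case False
  define k p where "k = card J" and "p = (\<Prod>i\<in>J. a i + b i)"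
  have k: "k > 0" using J by (simp add: k_def card_gt_0_iff)
  have pos: "a i + b i > 0" if "i \<in> J" for i
    using False nonneg(1,2)[OF that] that by (metis add_nonneg_nonneg less_eq_real_def)
  then have p: "p > 0" unfolding p_def by (rule prod_pos)
  \<comment> \<open>A generic \<open>c\<close> allows the estimate to serve for \<open>c = a\<close>
    and for \<open>c = b\<close>.\<close>
  have bound: "z \<le> (C * p) powr (1 / k) * (\<Sum>i\<in>J. c i / (a i + b i) / k)"
    if z: "z \<ge> 0" "z ^ k \<le> C * prod c J" and c: "\<And>i. i \<in> J \<Longrightarrow> c i \<ge> 0" for z c
  proof -
    have "z = (z ^ k) powr (1 / k)"
    proof (cases "z = 0")
      case True then show ?thesis using k by (simp add: power_0_left)
    next
      case False then show ?thesis using k z(1) by (simp flip: powr_realpow add: powr_powr)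
    qed
    also have "\<dots> \<le> (C * prod c J) powr (1 / k)"
      using z by (intro powr_mono2) auto
    also have "C * prod c J = (C * p) * (\<Prod>i\<in>J. c i / (a i + b i))"
      using p by (simp add: prod_dividef p_def)
    also have "\<dots> powr (1 / k) = (C * p) powr (1 / k) * (\<Prod>i\<in>J. c i / (a i + b i)) powr (1 / k)"
      by (rule powr_mult)
    also have "\<dots> \<le> (C * p) powr (1 / k) * (\<Sum>i\<in>J. c i / (a i + b i) / k)"
      unfolding k_def using c pos
      by (intro mult_left_mono arith_geom_mean J) (auto intro!: divide_nonneg_pos)
    finally show ?thesis .
  qed
  have "s + t \<le> (C * p) powr (1 / k) * (\<Sum>i\<in>J. a i / (a i + b i) / k + b i / (a i + b i) / k)"
    using bound[OF nonneg(3) s[folded k_def] nonneg(1)] bound[OF nonneg(4) t[folded k_def] nonneg(2)]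
    by (simp add: sum.distrib distrib_left)
  also have "(\<Sum>i\<in>J. a i / (a i + b i) / k + b i / (a i + b i) / k) = (\<Sum>i\<in>J. 1 / k)"
    by (rule sum.cong[OF refl]) (use pos in \<open>force simp flip: add_divide_distrib\<close>)
  also have "\<dots> = 1" using k by (simp add: k_def)
  finally have "(s + t) ^ k \<le> ((C * p) powr (1 / k)) ^ k"
    using nonneg(3,4) by (intro power_mono) auto
  \<comment> \<open>The root is undone by power laws for a positive base; for \<open>C = 0\<close>
    both sides vanish because \<open>k > 0\<close>.\<close>
  also have "\<dots> = C * p"
    using k p nonneg(5) by (cases "C = 0") (auto simp flip: powr_realpow simp: powr_powr power_0_left)
  finally show ?thesis by (simp add: k_def p_def)
qed

text \<open>Induction on the set \<open>S\<close> of points on which members of \<open>F\<close> may differ: splitting \<open>F\<close> at a point \<open>j\<close>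
  splits the traces on the \<open>k\<close> sets \<open>A i\<close> containing \<open>j\<close>, and Mahler's inequality recombines them.\<close>

lemma shearer_aux:
  fixes A :: "'i \<Rightarrow> 'b set"
  assumes "finite S" and I: "finite I" and k: "k > 0"
    and "\<And>j. j \<in> S \<Longrightarrow> card {i\<in>I. j \<in> A i} = k"
    and "\<And>B. B \<in> F \<Longrightarrow> B - S = D"
  shows "card F ^ k \<le> (\<Prod>i\<in>I. card ((\<lambda>B. B \<inter> A i) ` F))"
  using assms(1,4,5)
proof (induction S arbitrary: D F rule: finite_induct)
  case empty
  \<comment> \<open>An empty \<open>F\<close> gives \<open>0 ^ k = 0\<close> since
    \<open>k > 0\<close>; for \<open>F = {D}\<close> every trace set is a singleton, so both sides
    are 1.\<close>
  then have "F \<subseteq> {D}" by auto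
  then consider "F = {}" | "F = {D}" by blast
  then show ?case by cases (use k in \<open>auto simp: zero_power\<close>)
next
  case (insert j S)
  define F0 F1 where "F0 = {B \<in> F. j \<notin> B}" and "F1 = {B \<in> F. j \<in> B}"
  define J where "J = {i \<in> I. j \<in> A i}"
  define tr where "tr F i = (\<lambda>B. B \<inter> A i) ` F" for F i
  have JI: "J \<subseteq> I" "finite J" "card J = k" using I insert.prems(1)[of j] by (auto simp: J_def)
  have "F \<subseteq> (\<lambda>B. B \<union> D) ` Pow (insert j S)"
  proof
    fix B assume "B \<in> F"
    then have "B = (B \<inter> insert j S) \<union> D" using insert.prems(2) by blast
    then show "B \<in> (\<lambda>B. B \<union> D) ` Pow (insert j S)" by (rule image_eqI) simp
  qed
  then have finF: "finite F" using insert.hyps(1) by (auto intro: finite_subset)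
  have fin: "finite (tr F i)" for i using finF by (simp add: tr_def)
  have cardF: "card F = card F0 + card F1"
    using finF by (subst card_Un_disjoint[symmetric]) (auto simp: F0_def F1_def intro: arg_cong[of _ _ card])
  have IH: "card F0 ^ k \<le> (\<Prod>i\<in>I. card (tr F0 i))" "card F1 ^ k \<le> (\<Prod>i\<in>I. card (tr F1 i))"
    unfolding tr_def
  proof -
    \<comment> \<open>Members of \<open>F0\<close> and of \<open>F1\<close> again agree outside the
      smaller set \<open>S\<close>; the fixed part changes only by whether it contains
      \<open>j\<close>.\<close>
    show "card F0 ^ k \<le> (\<Prod>i\<in>I. card ((\<lambda>B. B \<inter> A i) ` F0))"
      by (rule insert.IH[of F0 "D - {j}"]) (use insert.prems in \<open>auto simp: F0_def\<close>)
    show "card F1 ^ k \<le> (\<Prod>i\<in>I. card ((\<lambda>B. B \<inter> A i) ` F1))"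
      by (rule insert.IH[of F1 "insert j D"]) (use insert.prems insert.hyps in \<open>auto simp: F1_def\<close>)
  qed
  \<comment> \<open>For \<open>i\<close> outside \<open>J\<close> the traces do not see
    \<open>j\<close>. These factors are not split but bounded by their value for all of
    \<open>F\<close>, which serves as Mahler's constant.\<close>
  define C where "C = (\<Prod>i\<in>I - J. card (tr F i))"
  have le: "(\<Prod>i\<in>I. card (tr F' i)) \<le> C * (\<Prod>i\<in>J. card (tr F' i))" if "F' \<subseteq> F" for F'
  proof -
    have "(\<Prod>i\<in>I - J. card (tr F' i)) \<le> C"
      unfolding C_def by (intro prod_mono) (use that fin in \<open>auto simp: tr_def intro!: card_mono\<close>)
    then show ?thesis by (subst prod.subset_diff[OF JI(1) I]) simp
  qed
  have F01: "F0 \<subseteq> F" "F1 \<subseteq> F" by (auto simp: F0_def F1_def)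
  \<comment> \<open>For \<open>i\<close> in \<open>J\<close> a trace records whether
    \<open>j\<close> is a member, so the traces of \<open>F0\<close> and \<open>F1\<close> are
    disjoint.\<close>
  have split: "card (tr F i) = card (tr F0 i) + card (tr F1 i)" if "i \<in> J" for i
  proof -
    have "j \<in> A i" using that by (simp add: J_def)
    then have "tr F0 i \<inter> tr F1 i = {}" by (auto simp: tr_def F0_def F1_def)
    moreover have "tr F i = tr F0 i \<union> tr F1 i" by (auto simp: tr_def F0_def F1_def)
    ultimately show ?thesis
      using finF by (simp add: card_Un_disjoint tr_def F0_def F1_def)
  qed
  have "(real (card F0) + real (card F1)) ^ card J
      \<le> real C * (\<Prod>i\<in>J. real (card (tr F0 i)) + real (card (tr F1 i)))"
  proof (rule mahler_prod_add_ge)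
    show "J \<noteq> {}" using JI k by auto
    show "real (card F0) ^ card J \<le> real C * (\<Prod>i\<in>J. real (card (tr F0 i)))"
      using order_trans[OF IH(1) le[OF F01(1)]] JI(3) by (simp flip: of_nat_power of_nat_mult of_nat_prod)
    show "real (card F1) ^ card J \<le> real C * (\<Prod>i\<in>J. real (card (tr F1 i)))"
      using order_trans[OF IH(2) le[OF F01(2)]] JI(3) by (simp flip: of_nat_power of_nat_mult of_nat_prod)
  qed (use JI in auto)
  also have "\<dots> = real (C * (\<Prod>i\<in>J. card (tr F i)))" by (simp add: split)
  also have "C * (\<Prod>i\<in>J. card (tr F i)) = (\<Prod>i\<in>I. card (tr F i))"
    unfolding C_def by (rule prod.subset_diff[OF JI(1) I, symmetric])
  finally show ?case
    unfolding cardF JI(3) tr_def[symmetric] by (simp flip: of_nat_add of_nat_power of_nat_prod)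
qed

text \<open>For a family inside \<open>Pow S\<close> the common part outside \<open>S\<close> is
  empty.\<close>

lemma shearer_counting:
  fixes A :: "'i \<Rightarrow> 'b set"
  assumes "finite S" "finite I" "k > 0" "\<And>j. j \<in> S \<Longrightarrow> card {i\<in>I. j \<in> A i} = k" "F \<subseteq> Pow S"
  shows "card F ^ k \<le> (\<Prod>i\<in>I. card ((\<lambda>B. B \<inter> A i) ` F))"
  by (rule shearer_aux[of S I k A F "{}"]) (use assms in auto)

section \<open>Subspaces of a finite coordinate space\<close>

abbreviation vsub :: "nat \<Rightarrow> 'a::field vec set set" where
  "vsub n \<equiv> subspaces class_ring (module_vec TYPE('a) n)"

abbreviation vdim :: "nat \<Rightarrow> 'a::field vec set \<Rightarrow> nat" where
  "vdim n \<equiv> subspace_dim class_ring (module_vec TYPE('a) n)"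

text \<open>Replaces the module locales by closure conditions on vectors. Scalars range over the
  whole type, the carrier of \<open>class_ring\<close>.\<close>

lemma vsub_iff:
  "W \<in> vsub n \<longleftrightarrow> W \<subseteq> carrier_vec n \<and> 0\<^sub>v n \<in> W \<and> (\<forall>v\<in>W. \<forall>w\<in>W. v + w \<in> W) \<and>
     (\<forall>c. \<forall>v\<in>W. c \<cdot>\<^sub>v v \<in> W)"
  for W :: "'a::field vec set"
proof -
  interpret vec_space "TYPE('a)" n .
  show ?thesis
    using vectorspace_axioms module_axioms
    by (auto simp: subspaces_def VectorSpace.subspace_def submodule_def module_vec_simps)
qed

lemma vsubI:
  assumes "W \<subseteq> carrier_vec n" "0\<^sub>v n \<in> W" "\<And>v w. v \<in> W \<Longrightarrow> w \<in> W \<Longrightarrow> v + w \<in> W"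
    "\<And>c v. v \<in> W \<Longrightarrow> c \<cdot>\<^sub>v v \<in> W"
  shows "W \<in> vsub n"
  using assms by (auto simp: vsub_iff)

lemma vsubD:
  assumes "W \<in> vsub n"
  shows "W \<subseteq> carrier_vec n" "v \<in> W \<Longrightarrow> v \<in> carrier_vec n" "0\<^sub>v n \<in> W"
    "v \<in> W \<Longrightarrow> w \<in> W \<Longrightarrow> v + w \<in> W" "v \<in> W \<Longrightarrow> c \<cdot>\<^sub>v v \<in> W"
  using assms by (auto simp: vsub_iff)

section \<open>Dimension through cardinality\<close>

lemma card_carrier_vec: "card (carrier_vec n :: 'a::finite vec set) = CARD('a) ^ n"
proof -
  have "bij_betw list_of_vec (carrier_vec n :: 'a vec set) {xs. set xs \<subseteq> UNIV \<and> length xs = n}"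
    by (rule bij_betwI[where g = vec_of_list])
      (auto simp: vec_list list_vec intro: carrier_vecI)
  then show ?thesis
    using card_lists_length_eq[of "UNIV :: 'a set" n] by (simp add: bij_betw_same_card)
qed

lemma finite_carrier_vec: "finite (carrier_vec n :: 'a::finite vec set)"
  by (rule card_ge_0_finite) (simp add: card_carrier_vec)

lemma finite_vsub: "finite (vsub n :: 'a::{field,finite} vec set set)"
  by (rule finite_subset[of _ "Pow (carrier_vec n)"]) (auto simp: vsub_iff finite_carrier_vec)

lemma vsub_finite: "W \<in> vsub n \<Longrightarrow> finite W" for W :: "'a::{field,finite} vec set"
  using vsubD(1) finite_carrier_vec finite_subset by metis

text \<open>The columns of \<open>A\<close> are a basis of \<open>W\<close>: independence makes the
  map injective, spanning makes its image \<open>W\<close>. This gives coordinates on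
  \<open>W\<close> and ties its dimension to its cardinality.\<close>

lemma vsub_parametrization:
  fixes W :: "'a::{field,finite} vec set"
  assumes "W \<in> vsub n"
  obtains A where "A \<in> carrier_mat n (vdim n W)" "inj_on ((*\<^sub>v) A) (carrier_vec (vdim n W))"
    "(*\<^sub>v) A ` carrier_vec (vdim n W) = W"
proof -
  interpret vec_space "TYPE('a)" n .
  have sub: "VectorSpace.subspace class_ring W V" and sm: "submodule class_ring W V"
    using assms by (auto simp: subspaces_def VectorSpace.subspace_def)
  interpret W: vectorspace class_ring "vs W" by (rule subspace_is_vs[OF sub])
  \<comment> \<open>Finite dimension is immediate: the finite set \<open>W\<close> spans
    itself.\<close>
  have "W.span W = W"
    using W.in_own_span[of W] W.span_is_subset2[of W] by auto
  then have "W.fin_dim" using vsub_finite[OF assms] by (auto simp: W.fin_dim_def)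
  then obtain B where B: "finite B" "W.basis B" using W.finite_basis_exists by blast
  have BW: "B \<subseteq> W" and li: "lin_indpt B" and sp: "span B = W"
    using B(2) span_li_not_depend[of B W] sm by (auto simp: W.basis_def)
  have dim: "vdim n W = card B" using W.dim_basis[OF B] by (simp add: subspace_dim_def)
  obtain bs where bs: "set bs = B" "distinct bs" using finite_distinct_list[OF B(1)] by blast
  have len: "length bs = card B" using bs distinct_card by fastforce
  define A where "A = mat_of_cols n bs"
  have BC: "set bs \<subseteq> carrier_vec n" using BW bs vsubD(1)[OF assms] by auto
  have A: "A \<in> carrier_mat n (card B)" using len by (auto simp: A_def)
  have cols: "cols A = bs" using BC by (simp add: A_def)
  have im: "(*\<^sub>v) A ` carrier_vec (card B) = W"
    using col_space_eq[OF A] A sp by (auto simp: col_space_def cols bs)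
  have "inj_on ((*\<^sub>v) A) (carrier_vec (card B))"
  proof (rule inj_onI)
    fix x y assume xy: "x \<in> carrier_vec (card B)" "y \<in> carrier_vec (card B)" "A *\<^sub>v x = A *\<^sub>v y"
    then have "A *\<^sub>v (x - y) = 0\<^sub>v n" using A by (simp add: mult_minus_distrib_mat_vec)
    then have "x - y = 0\<^sub>v (card B)"
      using lin_depI[OF A, of "x - y"] xy li bs by (auto simp: cols)
    show "x = y"
    proof (rule eq_vecI)
      show "dim_vec x = dim_vec y" using xy by auto
      fix i assume "i < dim_vec y"
      then have "(x - y) $ i = 0" using \<open>x - y = _\<close> xy by auto
      then show "x $ i = y $ i" using xy \<open>i < _\<close> by auto
    qed
  qed
  with that[of A] A im dim show thesis by simp
qed

lemma card_vsub:
  fixes W :: "'a::{field,finite} vec set"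
  assumes "W \<in> vsub n"
  shows "card W = CARD('a) ^ vdim n W"
  using vsub_parametrization[OF assms] card_image card_carrier_vec by metis

lemma card_field_gt_1: "CARD('a::{field,finite}) > 1"
  using card_mono[of UNIV "{0, 1 :: 'a}"] by auto

text \<open>As the field has more than one element, powers determine exponents. Dimension formulas
  below are therefore proved by counting vectors.\<close>

lemma vdim_eq_iff:
  fixes W :: "'a::{field,finite} vec set"
  assumes "W \<in> vsub n"
  shows "vdim n W = d \<longleftrightarrow> card W = CARD('a) ^ d"
  using card_vsub[OF assms] card_field_gt_1[where 'a = 'a] by simp

lemma vdim_mono:
  fixes V W :: "'a::{field,finite} vec set"
  assumes "V \<in> vsub n" "W \<in> vsub n" "V \<subseteq> W"
  shows "vdim n V \<le> vdim n W"
  using card_mono[OF vsub_finite[OF assms(2)] assms(3)] card_field_gt_1[where 'a = 'a]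
  by (simp add: card_vsub[OF assms(1)] card_vsub[OF assms(2)])

lemma vdim_inj:
  fixes V W :: "'a::{field,finite} vec set"
  assumes "V \<in> vsub n" "W \<in> vsub n" "V \<subseteq> W" "vdim n V = vdim n W"
  shows "V = W"
  using card_subset_eq[OF vsub_finite[OF assms(2)] assms(3)] assms(4)
  by (simp add: card_vsub[OF assms(1)] card_vsub[OF assms(2)])

lemma carrier_vsub: "carrier_vec n \<in> vsub n"
  by (rule vsubI) auto

lemma vdim_carrier: "vdim n (carrier_vec n :: 'a::{field,finite} vec set) = n"
  by (simp add: vdim_eq_iff[OF carrier_vsub] card_carrier_vec)

lemma zero_vsub: "{0\<^sub>v n} \<in> vsub n"
  by (rule vsubI) auto

lemma vdim_zero: "vdim n {0\<^sub>v n :: 'a::{field,finite} vec} = 0"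
  by (simp add: vdim_eq_iff[OF zero_vsub])

lemma zero_subset_vsub: "V \<in> vsub n \<Longrightarrow> {0\<^sub>v n} \<subseteq> V"
  by (simp add: vsubD)

lemma vsub_Int: "V \<in> vsub n \<Longrightarrow> W \<in> vsub n \<Longrightarrow> V \<inter> W \<in> vsub n"
  by (auto simp: vsub_iff)

section \<open>Sums of subspaces and lines\<close>

abbreviation vsum :: "nat \<Rightarrow> 'a::field vec set \<Rightarrow> 'a vec set \<Rightarrow> 'a vec set" where
  "vsum n \<equiv> module.submodule_sum (module_vec TYPE('a) n)"

lemma vsum_eq: "vsum n V W = {v + w |v w. v \<in> V \<and> w \<in> W}" for V W :: "'a::field vec set"
proof -
  interpret vec_space "TYPE('a)" n .
  show ?thesis unfolding submodule_sum_def by (auto simp: module_vec_simps)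
qed

lemma vsum_vsub:
  assumes "V \<in> vsub n" "W \<in> vsub n"
  shows "vsum n V W \<in> vsub n"
proof -
  note V = vsubD[OF assms(1)] and W = vsubD[OF assms(2)]
  show ?thesis unfolding vsum_eq
  proof (rule vsubI, goal_cases)
    case 1 show ?case using V(2) W(2) by auto
    case 2 show ?case using V(3) W(3) by (force intro: exI[of _ "0\<^sub>v n"])
    case (3 v w)
    then obtain a b c d where *: "v = a + b" "w = c + d" "a \<in> V" "b \<in> W" "c \<in> V" "d \<in> W" by auto
    then have "a \<in> carrier_vec n" "b \<in> carrier_vec n" "c \<in> carrier_vec n" "d \<in> carrier_vec n"
      using V(2) W(2) by auto
    then have "v + w = (a + c) + (b + d)" using *(1,2) by (intro eq_vecI) auto
    then show ?case using * V(4) W(4) by blast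
  next
    case (4 k v)
    then obtain a b where *: "v = a + b" "a \<in> V" "b \<in> W" by auto
    then have "k \<cdot>\<^sub>v v = k \<cdot>\<^sub>v a + k \<cdot>\<^sub>v b" using V(2) W(2) smult_add_distrib_vec by metis
    then show ?case using * V(5) W(5) by blast
  qed
qed

lemma vsum_upper:
  assumes "V \<in> vsub n" "W \<in> vsub n"
  shows "V \<subseteq> vsum n V W" "W \<subseteq> vsum n V W"
proof -
  note V = vsubD[OF assms(1)] and W = vsubD[OF assms(2)]
  show "V \<subseteq> vsum n V W"
  proof
    fix v assume "v \<in> V"
    then have "v = v + 0\<^sub>v n" using V(2) by auto
    then show "v \<in> vsum n V W" unfolding vsum_eq using \<open>v \<in> V\<close> W(3) by blast
  qed
  show "W \<subseteq> vsum n V W"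
  proof
    fix v assume "v \<in> W"
    then have "v = 0\<^sub>v n + v" using W(2) by auto
    then show "v \<in> vsum n V W" unfolding vsum_eq using \<open>v \<in> W\<close> V(3) by blast
  qed
qed

lemma vsum_least: "U \<in> vsub n \<Longrightarrow> V \<subseteq> U \<Longrightarrow> W \<subseteq> U \<Longrightarrow> vsum n V W \<subseteq> U"
  unfolding vsum_eq using vsubD(4) by blast

definition vline :: "'a::field vec \<Rightarrow> 'a vec set" where
  "vline x = range (\<lambda>c. c \<cdot>\<^sub>v x)"

lemma vline_vsub:
  assumes "x \<in> carrier_vec n"
  shows "vline x \<in> vsub n"
proof (rule vsubI)
  show "0\<^sub>v n \<in> vline x" unfolding vline_def by (rule image_eqI[of _ _ 0]) (use assms in auto)
qed (use assms in \<open>auto simp: vline_def add_smult_distrib_vec[symmetric] smult_smult_assoc\<close>)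

lemma vline_self: "x \<in> vline x"
  unfolding vline_def by (rule image_eqI[of _ _ 1]) auto

lemma vline_subset: "V \<in> vsub n \<Longrightarrow> x \<in> V \<Longrightarrow> vline x \<subseteq> V"
  by (auto simp: vline_def vsub_iff)

text \<open>A line is an image of the scalar field; equality fails exactly for \<open>x\<close>
  zero, which \<open>vline\<close> admits.\<close>

lemma vdim_vline_le:
  fixes x :: "'a::{field,finite} vec"
  assumes "x \<in> carrier_vec n"
  shows "vdim n (vline x) \<le> 1"
proof -
  have "card (vline x) \<le> CARD('a) ^ 1"
    unfolding vline_def using card_image_le[OF finite, of _ UNIV] by simp
  then show ?thesis
    unfolding card_vsub[OF vline_vsub[OF assms]] by (rule power_le_imp_le_exp[OF card_field_gt_1])
qed

text \<open>The map \<open>(v, c)\<close> to \<open>v + c x\<close> is injective on pairs, so the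
  sum has \<open>card V * CARD('a)\<close> elements.\<close>

lemma vdim_vsum_vline:
  fixes V :: "'a::{field,finite} vec set"
  assumes V: "V \<in> vsub n" and x: "x \<in> carrier_vec n" "x \<notin> V"
  shows "vdim n (vsum n V (vline x)) = Suc (vdim n V)"
proof -
  have VC: "\<And>v. v \<in> V \<Longrightarrow> v \<in> carrier_vec n" using vsubD(2)[OF V] .
  have "inj_on (\<lambda>(v, c). v + c \<cdot>\<^sub>v x) (V \<times> UNIV)"
  proof (rule inj_onI, clarify)
    fix v w c d assume *: "v \<in> V" "w \<in> V" "v + c \<cdot>\<^sub>v x = w + d \<cdot>\<^sub>v x"
    have e: "v $ i + c * x $ i = w $ i + d * x $ i" if "i < n" for i
      using arg_cong[OF *(3), of "\<lambda>u. u $ i"] VC *(1,2) x(1) that by auto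
    have "c = d"
    proof (rule ccontr)
      assume "c \<noteq> d"
      \<comment> \<open>Solving \<open>v + c x = w + d x\<close> for \<open>x\<close> exhibits it as
        an element of \<open>V\<close>.\<close>
      have "x = inverse (c - d) \<cdot>\<^sub>v (w + (- 1) \<cdot>\<^sub>v v)"
      proof (rule eq_vecI)
        fix i assume "i < dim_vec (inverse (c - d) \<cdot>\<^sub>v (w + (- 1) \<cdot>\<^sub>v v))"
        then have i: "i < n" using VC[OF *(1)] VC[OF *(2)] by auto
        have "(c - d) * x $ i = w $ i - v $ i" using e[OF i] by (simp add: algebra_simps)
        then show "x $ i = (inverse (c - d) \<cdot>\<^sub>v (w + (- 1) \<cdot>\<^sub>v v)) $ i"
          using i VC[OF *(1)] VC[OF *(2)] \<open>c \<noteq> d\<close> by (auto simp: field_simps)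
      qed (use VC[OF *(1)] VC[OF *(2)] x in auto)
      then show False using vsubD(4,5)[OF V] *(1,2) x(2) by metis
    qed
    moreover from this have "v = w"
      using e VC[OF *(1)] VC[OF *(2)] by (intro eq_vecI) auto
    ultimately show "v = w \<and> c = d" by simp
  qed
  moreover have "(\<lambda>(v, c). v + c \<cdot>\<^sub>v x) ` (V \<times> UNIV) = vsum n V (vline x)"
    by (auto simp: vsum_eq vline_def)
  ultimately have "card (vsum n V (vline x)) = card V * CARD('a)"
    using card_image card_cartesian_product by metis
  then show ?thesis
    using vdim_eq_iff[OF vsum_vsub[OF V vline_vsub[OF x(1)]]] card_vsub[OF V] by simp
qed

text \<open>Vectors of \<open>W\<close> outside the current subspace are adjoined one at a time,
  each raising the dimension by one.\<close>

lemma vsub_between: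
  fixes V W :: "'a::{field,finite} vec set"
  assumes "V \<in> vsub n" "W \<in> vsub n" "V \<subseteq> W" "vdim n V \<le> d" "d \<le> vdim n W"
  obtains U where "U \<in> vsub n" "V \<subseteq> U" "U \<subseteq> W" "vdim n U = d"
proof -
  \<comment> \<open>The upper bound on \<open>d\<close> sits inside the induction formula, since it
    guarantees that a further vector of \<open>W\<close> exists.\<close>
  have "d \<le> vdim n W \<longrightarrow> (\<exists>U\<in>vsub n. V \<subseteq> U \<and> U \<subseteq> W \<and> vdim n U = d)"
    using assms(4)
  proof (induction rule: dec_induct)
    case base then show ?case using assms by blast
  next
    case (step d)
    show ?case
    proof
      assume d: "Suc d \<le> vdim n W"
      with step.IH obtain U where U: "U \<in> vsub n" "V \<subseteq> U" "U \<subseteq> W" "vdim n U = d" by auto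
      have "U \<noteq> W" using d U(4) by auto
      then obtain x where x: "x \<in> W" "x \<notin> U" using U(3) by blast
      have xc: "x \<in> carrier_vec n" using vsubD(2) assms(2) x(1) by blast
      let ?U = "vsum n U (vline x)"
      have "?U \<subseteq> W" by (rule vsum_least[OF assms(2) U(3) vline_subset[OF assms(2) x(1)]])
      moreover have "V \<subseteq> ?U" using U(2) vsum_upper(1)[OF U(1) vline_vsub[OF xc]] by blast
      moreover have "vdim n ?U = Suc d" using vdim_vsum_vline[OF U(1) xc x(2)] U(4) by simp
      moreover have "?U \<in> vsub n" by (rule vsum_vsub[OF U(1) vline_vsub[OF xc]])
      ultimately show "\<exists>U\<in>vsub n. V \<subseteq> U \<and> U \<subseteq> W \<and> vdim n U = Suc d" by blast
    qed
  qed
  with assms(5) that show thesis by blast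
qed

lemma zero_smult_vec: "0 \<cdot>\<^sub>v v = 0\<^sub>v (dim_vec v)" for v :: "'a::field vec"
  by (intro eq_vecI) auto

section \<open>Linear images and Grassmannians\<close>

lemma linear_image_vsub:
  assumes "U \<in> vsub m" "\<And>v. v \<in> carrier_vec m \<Longrightarrow> f v \<in> carrier_vec n"
    "\<And>v w. v \<in> carrier_vec m \<Longrightarrow> w \<in> carrier_vec m \<Longrightarrow> f (v + w) = f v + f w"
    "\<And>c v. v \<in> carrier_vec m \<Longrightarrow> f (c \<cdot>\<^sub>v v) = c \<cdot>\<^sub>v f v"
  shows "f ` U \<in> vsub n"
proof -
  note U = vsubD[OF assms(1)]
  have "f (0\<^sub>v m) = 0\<^sub>v n"
    using assms(4)[of "0\<^sub>v m" 0] assms(2)[of "0\<^sub>v m"] by (simp add: zero_smult_vec)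
  then have "0\<^sub>v n \<in> f ` U" using U(3) by (metis imageI)
  then show ?thesis
    using U by (intro vsubI) (auto simp: assms(2) assms(3)[symmetric] assms(4)[symmetric])
qed

lemma linear_vimage_vsub:
  assumes "U \<in> vsub n" "\<And>v. v \<in> carrier_vec m \<Longrightarrow> f v \<in> carrier_vec n"
    "\<And>v w. v \<in> carrier_vec m \<Longrightarrow> w \<in> carrier_vec m \<Longrightarrow> f (v + w) = f v + f w"
    "\<And>c v. v \<in> carrier_vec m \<Longrightarrow> f (c \<cdot>\<^sub>v v) = c \<cdot>\<^sub>v f v"
  shows "f -` U \<inter> carrier_vec m \<in> vsub m"
proof -
  note U = vsubD[OF assms(1)]
  have "f (0\<^sub>v m) = 0\<^sub>v n"
    using assms(4)[of "0\<^sub>v m" 0] assms(2)[of "0\<^sub>v m"] by (simp add: zero_smult_vec)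
  then show ?thesis using U by (intro vsubI) (auto simp: assms(3,4))
qed

definition grassmannian :: "nat \<Rightarrow> nat \<Rightarrow> 'a::field vec set set" where
  "grassmannian n k = {W \<in> vsub n. vdim n W = k}"

lemma finite_grassmannian: "finite (grassmannian n k :: 'a::{field,finite} vec set set)"
  by (rule finite_subset[OF _ finite_vsub[of n]]) (auto simp: grassmannian_def)

lemma card_grassmannian:
  "card (grassmannian n k :: 'a::{field,finite} vec set set) = gaussian_binomial TYPE('a) n k"
  by (simp add: grassmannian_def gaussian_binomial_def)

text \<open>An injective matrix map onto \<open>W\<close> carries subspaces of the coordinate space
  of dimension \<open>vdim n W\<close> bijectively to those of \<open>W\<close>, preserving
  cardinality and hence dimension. Thus the count depends only on the dimension of
  \<open>W\<close>.\<close>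

lemma card_subspaces_below:
  fixes W :: "'a::{field,finite} vec set"
  assumes W: "W \<in> vsub n"
  shows "card {U \<in> grassmannian n u. U \<subseteq> W} = gaussian_binomial TYPE('a) (vdim n W) u"
proof -
  define r where "r = vdim n W"
  obtain A where A: "A \<in> carrier_mat n r" and inj: "inj_on ((*\<^sub>v) A) (carrier_vec r)"
    and im: "(*\<^sub>v) A ` carrier_vec r = W"
    using vsub_parametrization[OF W] unfolding r_def .
  have lin: "A *\<^sub>v v \<in> carrier_vec n" "A *\<^sub>v (v + w) = A *\<^sub>v v + A *\<^sub>v w"
    "A *\<^sub>v (c \<cdot>\<^sub>v v) = c \<cdot>\<^sub>v (A *\<^sub>v v)"
    if "v \<in> carrier_vec r" "w \<in> carrier_vec r" for c v w
    using A that by (auto simp: mult_add_distrib_mat_vec mult_mat_vec)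
  have dim: "vdim n ((*\<^sub>v) A ` U) = vdim r U" if "U \<in> vsub r" for U
  proof -
    have "(*\<^sub>v) A ` U \<in> vsub n" by (rule linear_image_vsub[OF that]) (use lin in auto)
    moreover have "card ((*\<^sub>v) A ` U) = card U"
      using card_image inj_on_subset[OF inj vsubD(1)[OF that]] by blast
    ultimately show ?thesis by (simp add: vdim_eq_iff card_vsub[OF that])
  qed
  have "bij_betw ((`) ((*\<^sub>v) A)) (grassmannian r u) {U \<in> grassmannian n u. U \<subseteq> W}"
  proof (rule bij_betw_imageI)
    show "inj_on ((`) ((*\<^sub>v) A)) (grassmannian r u)"
    proof (rule inj_onI)
      fix U U' :: "'a vec set" assume "U \<in> grassmannian r u" "U' \<in> grassmannian r u"
      then have "U \<subseteq> carrier_vec r" "U' \<subseteq> carrier_vec r"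
        using vsubD(1) by (auto simp: grassmannian_def)
      moreover assume "(*\<^sub>v) A ` U = (*\<^sub>v) A ` U'"
      ultimately show "U = U'" using inj_on_image_eq_iff[OF inj] by blast
    qed
    show "(`) ((*\<^sub>v) A) ` grassmannian r u = {U \<in> grassmannian n u. U \<subseteq> W}"
    proof (intro equalityI subsetI)
      fix U' assume "U' \<in> (`) ((*\<^sub>v) A) ` grassmannian r u"
      then obtain U where U: "U' = (*\<^sub>v) A ` U" "U \<in> vsub r" "vdim r U = u"
        by (auto simp: grassmannian_def)
      have "U' \<in> vsub n" unfolding U(1) by (rule linear_image_vsub[OF U(2)]) (use lin in auto)
      then show "U' \<in> {U \<in> grassmannian n u. U \<subseteq> W}"
        using U dim[OF U(2)] im vsubD(1)[OF U(2)] by (auto simp: grassmannian_def)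
    next
      fix U' assume "U' \<in> {U \<in> grassmannian n u. U \<subseteq> W}"
      then have U': "U' \<in> vsub n" "vdim n U' = u" "U' \<subseteq> W" by (auto simp: grassmannian_def)
      let ?U = "(*\<^sub>v) A -` U' \<inter> carrier_vec r"
      have U: "?U \<in> vsub r" by (rule linear_vimage_vsub[OF U'(1)]) (use lin in auto)
      have eq: "(*\<^sub>v) A ` ?U = U'" using U'(3) im by auto
      then have "?U \<in> grassmannian r u" using dim[OF U] U U'(2) by (auto simp: grassmannian_def)
      then show "U' \<in> (`) ((*\<^sub>v) A) ` grassmannian r u" using eq by (metis imageI)
    qed
  qed
  then show ?thesis by (simp add: bij_betw_same_card card_grassmannian[symmetric] r_def)
qed

lemma gaussian_binomial_pos: "k \<le> n \<Longrightarrow> gaussian_binomial TYPE('a::{field,finite}) n k > 0"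
  by (rule vsub_between[OF zero_vsub carrier_vsub, of n k])
     (auto simp: zero_subset_vsub[OF carrier_vsub] vdim_zero vdim_carrier card_grassmannian[symmetric]
        card_gt_0_iff finite_grassmannian, auto simp: grassmannian_def)

section \<open>Bases determine a q-matroid\<close>

abbreviation q_matroid_on :: "nat \<Rightarrow> ('a::{field,finite} vec set \<Rightarrow> nat) \<Rightarrow> bool" where
  "q_matroid_on n \<rho> \<equiv> q_matroid class_ring (module_vec TYPE('a) n) \<rho>"

text \<open>Submodularity for \<open>V\<close> and the line, whose rank is at most its dimension,
  hence at most 1.\<close>

lemma rank_vline_le:
  fixes \<rho> :: "'a::{field,finite} vec set \<Rightarrow> nat"
  assumes "q_matroid_on n \<rho>" and V: "V \<in> vsub n" and x: "x \<in> carrier_vec n"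
  shows "\<rho> (vsum n V (vline x)) \<le> Suc (\<rho> V)"
proof -
  interpret q_matroid class_ring "module_vec TYPE('a) n" \<rho> by fact
  show ?thesis
    using rank_submodular[OF V vline_vsub[OF x]] rank_le_dim[OF vline_vsub[OF x]] vdim_vline_le[OF x]
    by linarith
qed

text \<open>Climbing from \<open>V\<close> to \<open>W\<close> one vector at a time, each step
  raises the dimension by exactly 1 and the rank by at most 1. The additive form avoids truncated
  subtraction.\<close>

lemma rank_diff_le_vdim_diff:
  fixes \<rho> :: "'a::{field,finite} vec set \<Rightarrow> nat"
  assumes M: "q_matroid_on n \<rho>" and V: "V \<in> vsub n" "W \<in> vsub n" "V \<subseteq> W"
  shows "\<rho> W + vdim n V \<le> \<rho> V + vdim n W"
  using V
proof (induction "vdim n W - vdim n V" arbitrary: V)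
  case 0
  then have "V = W" using vdim_mono vdim_inj by (metis diff_is_0_eq order_antisym)
  then show ?case by simp
next
  case (Suc d)
  then have "V \<noteq> W" by auto
  then obtain x where x: "x \<in> W" "x \<notin> V" using Suc.prems(3) by blast
  have xc: "x \<in> carrier_vec n" using vsubD(2)[OF Suc.prems(2) x(1)] .
  let ?V = "vsum n V (vline x)"
  have dim: "vdim n ?V = Suc (vdim n V)" by (rule vdim_vsum_vline[OF Suc.prems(1) xc x(2)])
  have "\<rho> W + vdim n ?V \<le> \<rho> ?V + vdim n W"
  proof (rule Suc.hyps(1))
    show "d = vdim n W - vdim n ?V" using Suc.hyps(2) dim by simp
    show "?V \<in> vsub n" by (rule vsum_vsub[OF Suc.prems(1) vline_vsub[OF xc]])
    show "?V \<subseteq> W"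
      by (rule vsum_least[OF Suc.prems(2,3) vline_subset[OF Suc.prems(2) x(1)]])
  qed (rule Suc.prems(2))
  then show ?case using rank_vline_le[OF M Suc.prems(1) xc] dim by linarith
qed

text \<open>Dimension minus rank is monotone by the previous lemma, so if it vanishes on
  \<open>W\<close> it vanishes on \<open>V\<close>.\<close>

lemma subspace_of_independent:
  fixes \<rho> :: "'a::{field,finite} vec set \<Rightarrow> nat"
  assumes M: "q_matroid_on n \<rho>" and V: "V \<in> vsub n" "W \<in> vsub n" "V \<subseteq> W" and "\<rho> W = vdim n W"
  shows "\<rho> V = vdim n V"
proof -
  interpret q_matroid class_ring "module_vec TYPE('a) n" \<rho> by fact
  show ?thesis using rank_diff_le_vdim_diff[OF M V] rank_le_dim[OF V(1)] assms(5) by linarith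
qed

text \<open>Let \<open>J\<close> be maximal between \<open>I\<close> and \<open>V\<close> among the
  subspaces of rank \<open>\<rho> I\<close>. If some \<open>x\<close> of \<open>V\<close> lay
  outside \<open>J\<close>, submodularity for \<open>J\<close> and \<open>I + vline x\<close>, which
  meet in at least \<open>I\<close>, would give \<open>J + vline x\<close> the same rank, against
  maximality.\<close>

lemma rank_eq_if_rank_vline_eq:
  fixes \<rho> :: "'a::{field,finite} vec set \<Rightarrow> nat"
  assumes M: "q_matroid_on n \<rho>" and V: "I \<in> vsub n" "V \<in> vsub n" "I \<subseteq> V"
    and line: "\<And>x. x \<in> V \<Longrightarrow> \<rho> (vsum n I (vline x)) = \<rho> I"
  shows "\<rho> V = \<rho> I"
proof -
  interpret q_matroid class_ring "module_vec TYPE('a) n" \<rho> by fact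
  let ?\<J> = "{J \<in> vsub n. I \<subseteq> J \<and> J \<subseteq> V \<and> \<rho> J = \<rho> I}"
  have "finite ?\<J>" by (rule finite_subset[OF _ finite_vsub]) auto
  moreover have "I \<in> ?\<J>" using V by auto
  ultimately have "\<exists>J\<in>?\<J>. I \<subseteq> J \<and> (\<forall>J'\<in>?\<J>. J \<subseteq> J' \<longrightarrow> J = J')" by (rule finite_has_maximal2)
  then obtain J where J: "J \<in> ?\<J>" and "I \<subseteq> J \<and> (\<forall>J'\<in>?\<J>. J \<subseteq> J' \<longrightarrow> J = J')" by (rule bexE)
  then have max: "\<And>J'. J' \<in> ?\<J> \<Longrightarrow> J \<subseteq> J' \<Longrightarrow> J' = J" by blast
  have "V \<subseteq> J"
  proof (rule ccontr)
    assume "\<not> V \<subseteq> J"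
    then obtain x where x: "x \<in> V" "x \<notin> J" by blast
    have xc: "x \<in> carrier_vec n" using vsubD(2)[OF V(2) x(1)] .
    note L = vline_vsub[OF xc]
    let ?I = "vsum n I (vline x)" and ?J = "vsum n J (vline x)"
    have J': "J \<in> vsub n" "I \<subseteq> J" "J \<subseteq> V" "\<rho> J = \<rho> I" using J by auto
    note sub = vsum_vsub[OF V(1) L] vsum_vsub[OF J'(1) L]
    have I1: "I \<subseteq> ?I" "vline x \<subseteq> ?I" by (rule vsum_upper[OF V(1) L])+
    have J1: "J \<subseteq> ?J" "vline x \<subseteq> ?J" by (rule vsum_upper[OF J'(1) L])+
    \<comment> \<open>Submodularity speaks about the sum of \<open>J\<close> and \<open>?I\<close>,
      so \<open>?J\<close> is first placed inside it.\<close>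
    have "?J \<subseteq> vsum n J ?I"
      using vsum_upper[OF J'(1) sub(1)] I1 by (intro vsum_least vsum_vsub J' sub) auto
    then have "\<rho> ?J \<le> \<rho> (vsum n J ?I)" by (intro rank_mono sub vsum_vsub J')
    moreover have "\<rho> (vsum n J ?I) + \<rho> (J \<inter> ?I) \<le> \<rho> J + \<rho> ?I" by (rule rank_submodular[OF J'(1) sub(1)])
    moreover have "\<rho> I \<le> \<rho> (J \<inter> ?I)" using J'(2) I1 by (intro rank_mono V vsub_Int J' sub) auto
    moreover have "\<rho> J \<le> \<rho> ?J" by (rule rank_mono[OF J'(1) sub(2) J1(1)])
    ultimately have "\<rho> ?J = \<rho> I" using line[OF x(1)] J'(4) by linarith
    moreover have "?J \<subseteq> V" by (rule vsum_least[OF V(2) J'(3) vline_subset[OF V(2) x(1)]])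
    ultimately have "?J \<in> ?\<J>" using sub(2) J'(2) J1(1) by auto
    then have "?J = J" by (rule max[OF _ J1(1)])
    then show False using J1(2) vline_self x(2) by blast
  qed
  then have "J = V" using J by auto
  then show ?thesis using J by simp
qed

text \<open>A maximal independent \<open>J\<close> between \<open>I\<close> and \<open>V\<close>
  works: no vector of \<open>V\<close> can raise its rank, so
  \<open>rank_eq_if_rank_vline_eq\<close> yields \<open>\<rho> V = \<rho> J\<close>.\<close>

lemma independent_extension:
  fixes \<rho> :: "'a::{field,finite} vec set \<Rightarrow> nat"
  assumes M: "q_matroid_on n \<rho>" and V: "I \<in> vsub n" "V \<in> vsub n" "I \<subseteq> V" "\<rho> I = vdim n I"
  obtains J where "J \<in> vsub n" "I \<subseteq> J" "J \<subseteq> V" "\<rho> J = vdim n J" "vdim n J = \<rho> V"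
proof -
  interpret q_matroid class_ring "module_vec TYPE('a) n" \<rho> by fact
  let ?\<J> = "{J \<in> vsub n. I \<subseteq> J \<and> J \<subseteq> V \<and> \<rho> J = vdim n J}"
  have "finite ?\<J>" by (rule finite_subset[OF _ finite_vsub]) auto
  moreover have "I \<in> ?\<J>" using V by auto
  ultimately have "\<exists>J\<in>?\<J>. I \<subseteq> J \<and> (\<forall>J'\<in>?\<J>. J \<subseteq> J' \<longrightarrow> J = J')" by (rule finite_has_maximal2)
  then obtain J where J: "J \<in> ?\<J>" and "I \<subseteq> J \<and> (\<forall>J'\<in>?\<J>. J \<subseteq> J' \<longrightarrow> J = J')" by (rule bexE)
  then have max: "\<And>J'. J' \<in> ?\<J> \<Longrightarrow> J \<subseteq> J' \<Longrightarrow> J' = J" by blast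
  have J': "J \<in> vsub n" "I \<subseteq> J" "J \<subseteq> V" "\<rho> J = vdim n J" using J by auto
  have "\<rho> V = \<rho> J"
  proof (rule rank_eq_if_rank_vline_eq[OF M J'(1) V(2) J'(3)])
    fix x assume x: "x \<in> V"
    have xc: "x \<in> carrier_vec n" using vsubD(2)[OF V(2) x] .
    note L = vline_vsub[OF xc]
    let ?J = "vsum n J (vline x)"
    have sub: "?J \<in> vsub n" by (rule vsum_vsub[OF J'(1) L])
    have up: "J \<subseteq> ?J" "vline x \<subseteq> ?J" by (rule vsum_upper[OF J'(1) L])+
    have sV: "?J \<subseteq> V" by (rule vsum_least[OF V(2) J'(3) vline_subset[OF V(2) x]])
    show "\<rho> ?J = \<rho> J"
    proof (cases "x \<in> J")
      case True
      then have "?J = J" using up(1) vsum_least[OF J'(1) order_refl vline_subset[OF J'(1)]] by blast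
      then show ?thesis by simp
    next
      case False
      then have dim: "vdim n ?J = Suc (vdim n J)" by (rule vdim_vsum_vline[OF J'(1) xc])
      have "?J \<noteq> J" using False up(2) vline_self by blast
      then have "?J \<notin> ?\<J>" using max[OF _ up(1)] by blast
      \<comment> \<open>By maximality \<open>?J\<close> is dependent, so its rank is strictly below
        \<open>vdim n J + 1\<close> and at least \<open>\<rho> J = vdim n J\<close>.\<close>
      then have "\<rho> ?J \<noteq> vdim n ?J" using sub up(1) sV J'(2) by blast
      moreover have "\<rho> J \<le> \<rho> ?J" by (rule rank_mono[OF J'(1) sub up(1)])
      ultimately show ?thesis using rank_le_dim[OF sub] dim J'(4) by linarith
    qed
  qed
  then show thesis using that J' by simp
qed

section \<open>Families of bases\<close>

text \<open>These are the bases when \<open>\<rho>\<close> has total rank \<open>r\<close>. Taking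
  \<open>r\<close> as a parameter places all families inside the power set of one
  \<open>grassmannian n r\<close>.\<close>

definition q_bases :: "nat \<Rightarrow> nat \<Rightarrow> ('a::field vec set \<Rightarrow> nat) \<Rightarrow> 'a vec set set" where
  "q_bases n r \<rho> = {B \<in> grassmannian n r. \<rho> B = r}"

lemma independent_extends_to_basis:
  fixes \<rho> :: "'a::{field,finite} vec set \<Rightarrow> nat"
  assumes M: "q_matroid_on n \<rho>" and I: "I \<in> vsub n" "\<rho> I = vdim n I" and r: "\<rho> (carrier_vec n) = r"
  obtains B where "B \<in> q_bases n r \<rho>" "I \<subseteq> B"
proof -
  obtain J where "J \<in> vsub n" "I \<subseteq> J" "\<rho> J = vdim n J" "vdim n J = r"
    using independent_extension[OF M I(1) carrier_vsub vsubD(1)[OF I(1)] I(2)] unfolding r .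
  then show thesis by (intro that[of J]) (auto simp: q_bases_def grassmannian_def)
qed

lemma zero_independent:
  fixes \<rho> :: "'a::{field,finite} vec set \<Rightarrow> nat"
  assumes M: "q_matroid_on n \<rho>"
  shows "\<rho> {0\<^sub>v n} = vdim n {0\<^sub>v n :: 'a vec}"
proof -
  interpret q_matroid class_ring "module_vec TYPE('a) n" \<rho> by fact
  show ?thesis using rank_le_dim[OF zero_vsub] by (simp add: vdim_zero)
qed

lemma q_bases_nonempty:
  fixes \<rho> :: "'a::{field,finite} vec set \<Rightarrow> nat"
  assumes "q_matroid_on n \<rho>" "\<rho> (carrier_vec n) = r"
  shows "q_bases n r \<rho> \<noteq> {}"
  using independent_extends_to_basis[OF assms(1) zero_vsub zero_independent[OF assms(1)] assms(2)] by blast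

text \<open>A maximal independent \<open>J\<close> in \<open>V\<close> has dimension
  \<open>\<rho> V\<close> and extends to a basis for \<open>\<rho>\<close>. That is also a basis for
  \<open>\<rho>'\<close>, so its subspace \<open>J\<close> is independent for \<open>\<rho>'\<close>
  and bounds \<open>\<rho>' V\<close> from below.\<close>

lemma rank_le_of_q_bases_subset:
  fixes \<rho> \<rho>' :: "'a::{field,finite} vec set \<Rightarrow> nat"
  assumes M: "q_matroid_on n \<rho>" "q_matroid_on n \<rho>'" and r: "\<rho> (carrier_vec n) = r"
    and sub: "q_bases n r \<rho> \<subseteq> q_bases n r \<rho>'" and V: "V \<in> vsub n"
  shows "\<rho> V \<le> \<rho>' V"
proof -
  interpret M': q_matroid class_ring "module_vec TYPE('a) n" \<rho>' by fact
  obtain J where J: "J \<in> vsub n" "J \<subseteq> V" "\<rho> J = vdim n J" "vdim n J = \<rho> V"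
    using independent_extension[OF M(1) zero_vsub V zero_subset_vsub[OF V] zero_independent[OF M(1)]] .
  obtain B where B: "B \<in> q_bases n r \<rho>" "J \<subseteq> B"
    using independent_extends_to_basis[OF M(1) J(1,3) r] .
  then have "B \<in> vsub n" "\<rho>' B = vdim n B" using sub by (auto simp: q_bases_def grassmannian_def)
  then have "\<rho>' J = vdim n J" using subspace_of_independent[OF M(2) J(1) _ B(2)] by blast
  then show ?thesis using M'.rank_mono[OF J(1) V J(2)] J(4) by simp
qed

text \<open>Both inequalities hold on subspaces; off subspaces the functions agree by
  extensionality.\<close>

lemma q_bases_inj:
  fixes \<rho> \<rho>' :: "'a::{field,finite} vec set \<Rightarrow> nat"
  assumes M: "q_matroid_on n \<rho>" "q_matroid_on n \<rho>'"
    and r: "\<rho> (carrier_vec n) = r" "\<rho>' (carrier_vec n) = r"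
    and eq: "q_bases n r \<rho> = q_bases n r \<rho>'"
  shows "\<rho> = \<rho>'"
proof (rule extensionalityI)
  show "\<rho> \<in> extensional (vsub n)" by (rule q_matroid.extensional[OF M(1)])
  show "\<rho>' \<in> extensional (vsub n)" by (rule q_matroid.extensional[OF M(2)])
  fix V :: "'a vec set" assume V: "V \<in> vsub n"
  show "\<rho> V = \<rho>' V"
  proof (rule order_antisym)
    show "\<rho> V \<le> \<rho>' V" by (rule rank_le_of_q_bases_subset[OF M r(1) _ V]) (simp add: eq)
    show "\<rho>' V \<le> \<rho> V" by (rule rank_le_of_q_bases_subset[OF M(2,1) r(2) _ V]) (simp add: eq)
  qed
qed

section \<open>Quotients and contraction\<close>

text \<open>A linear surjection with kernel \<open>U\<close> models the quotient by \<open>U\<close>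
  within coordinate spaces, so that cosets can be left behind.\<close>

locale vec_quotient =
  fixes n m :: nat and U :: "'a::{field,finite} vec set" and \<psi> :: "'a vec \<Rightarrow> 'a vec"
  assumes closed: "v \<in> carrier_vec n \<Longrightarrow> \<psi> v \<in> carrier_vec m"
    and add: "v \<in> carrier_vec n \<Longrightarrow> w \<in> carrier_vec n \<Longrightarrow> \<psi> (v + w) = \<psi> v + \<psi> w"
    and smult: "v \<in> carrier_vec n \<Longrightarrow> \<psi> (c \<cdot>\<^sub>v v) = c \<cdot>\<^sub>v \<psi> v"
    and surj: "\<psi> ` carrier_vec n = carrier_vec m"
    and kernel: "{v \<in> carrier_vec n. \<psi> v = 0\<^sub>v m} = U"
begin

lemma image_vsub: "W \<in> vsub n \<Longrightarrow> \<psi> ` W \<in> vsub m"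
  by (rule linear_image_vsub) (auto simp: closed add smult)

lemma vimage_vsub: "V \<in> vsub m \<Longrightarrow> \<psi> -` V \<inter> carrier_vec n \<in> vsub n"
  by (rule linear_vimage_vsub) (auto simp: closed add smult)

lemma kernel_vsub: "U \<in> vsub n"
proof -
  have "U = \<psi> -` {0\<^sub>v m} \<inter> carrier_vec n" using kernel by auto
  then show ?thesis using vimage_vsub[OF zero_vsub] by simp
qed

lemma kernel_subset_vimage: "V \<in> vsub m \<Longrightarrow> U \<subseteq> \<psi> -` V \<inter> carrier_vec n"
  using kernel vsubD(3) by auto

lemma image_vimage: "V \<subseteq> carrier_vec m \<Longrightarrow> \<psi> ` (\<psi> -` V \<inter> carrier_vec n) = V"
  unfolding surj[symmetric] by blast

text \<open>The difference is written with the scalar \<open>- 1\<close> because \<open>vsub\<close>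
  offers closure under sums and scalar multiples.\<close>

lemma diff_in_kernel:
  assumes "v \<in> carrier_vec n" "w \<in> carrier_vec n" "\<psi> v = \<psi> w"
  shows "v + (- 1) \<cdot>\<^sub>v w \<in> U" "v = w + (v + (- 1) \<cdot>\<^sub>v w)"
proof -
  have "\<psi> (v + (- 1) \<cdot>\<^sub>v w) = \<psi> w + (- 1) \<cdot>\<^sub>v \<psi> w" using assms by (simp add: add smult)
  also have "\<dots> = 0\<^sub>v m" using closed[OF assms(2)] by (intro eq_vecI) auto
  finally show "v + (- 1) \<cdot>\<^sub>v w \<in> U" using kernel assms by auto
  show "v = w + (v + (- 1) \<cdot>\<^sub>v w)" using assms by (intro eq_vecI) auto
qed

lemma vimage_image:
  assumes "W \<in> vsub n" "U \<subseteq> W"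
  shows "\<psi> -` (\<psi> ` W) \<inter> carrier_vec n = W"
proof (intro equalityI subsetI)
  fix v assume "v \<in> \<psi> -` (\<psi> ` W) \<inter> carrier_vec n"
  then obtain w where w: "w \<in> W" "\<psi> v = \<psi> w" "v \<in> carrier_vec n" by auto
  note d = diff_in_kernel[OF w(3) vsubD(2)[OF assms(1) w(1)] w(2)]
  have "w + (v + (- 1) \<cdot>\<^sub>v w) \<in> W" by (rule vsubD(4)[OF assms(1) w(1)]) (use d(1) assms(2) in blast)
  then show "v \<in> W" using d(2) by simp
qed (use vsubD(2)[OF assms(1)] in auto)

text \<open>Rank-nullity by counting: the preimage of \<open>V\<close> is in bijection with
  \<open>V \<times> U\<close>, a preimage being chosen for each \<open>v\<close> and shifted by the
  kernel.\<close>

lemma vdim_vimage: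
  assumes V: "V \<in> vsub m"
  shows "vdim n (\<psi> -` V \<inter> carrier_vec n) = vdim m V + vdim n U"
proof -
  \<comment> \<open>An arbitrary set-theoretic section of \<open>\<psi>\<close>; the count asks only
    for a bijection.\<close>
  define s where "s = inv_into (carrier_vec n) \<psi>"
  have s: "s v \<in> carrier_vec n" "\<psi> (s v) = v" if "v \<in> V" for v
  proof -
    have "v \<in> \<psi> ` carrier_vec n" using that vsubD(2)[OF V] surj by simp
    then show "s v \<in> carrier_vec n" "\<psi> (s v) = v"
      unfolding s_def by (rule inv_into_into, rule f_inv_into_f)
  qed
  have UC: "w \<in> carrier_vec n" "\<psi> w = 0\<^sub>v m" if "w \<in> U" for w using that kernel by auto
  have \<psi>s: "\<psi> (s v + w) = v" if "v \<in> V" "w \<in> U" for v w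
    using that s UC vsubD(2)[OF V] by (simp add: add)
  have "bij_betw (\<lambda>(v, w). s v + w) (V \<times> U) (\<psi> -` V \<inter> carrier_vec n)"
  proof (rule bij_betw_imageI)
    show "inj_on (\<lambda>(v, w). s v + w) (V \<times> U)"
    proof (rule inj_onI, clarify)
      fix v w v' w' assume *: "v \<in> V" "w \<in> U" "v' \<in> V" "w' \<in> U" "s v + w = s v' + w'"
      have "v = v'" using \<psi>s[OF *(1,2)] \<psi>s[OF *(3,4)] *(5) by simp
      moreover have "w = w'"
      proof (rule eq_vecI)
        note C = s(1)[OF *(3)] UC(1)[OF *(2)] UC(1)[OF *(4)]
        show "dim_vec w = dim_vec w'" using C by auto
        fix i assume "i < dim_vec w'"
        then show "w $ i = w' $ i"
          using arg_cong[OF *(5), of "\<lambda>x. x $ i"] C unfolding \<open>v = v'\<close> by auto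
      qed
      ultimately show "v = v' \<and> w = w'" by simp
    qed
    show "(\<lambda>(v, w). s v + w) ` (V \<times> U) = \<psi> -` V \<inter> carrier_vec n"
    proof (intro equalityI subsetI)
      fix x assume "x \<in> (\<lambda>(v, w). s v + w) ` (V \<times> U)"
      then show "x \<in> \<psi> -` V \<inter> carrier_vec n" using \<psi>s s UC by auto
    next
      fix x assume x: "x \<in> \<psi> -` V \<inter> carrier_vec n"
      then have *: "x \<in> carrier_vec n" "\<psi> x \<in> V" by auto
      note d = diff_in_kernel[OF *(1) s(1)[OF *(2)] s(2)[OF *(2), symmetric]]
      show "x \<in> (\<lambda>(v, w). s v + w) ` (V \<times> U)"
        by (rule image_eqI[of _ _ "(\<psi> x, x + (- 1) \<cdot>\<^sub>v s (\<psi> x))"]) (use d * in auto)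
    qed
  qed
  then have "card (\<psi> -` V \<inter> carrier_vec n) = card V * card U"
    by (metis bij_betw_same_card card_cartesian_product)
  then show ?thesis
    by (simp add: vdim_eq_iff[OF vimage_vsub[OF V]] card_vsub[OF V] card_vsub[OF kernel_vsub] power_add)
qed

lemma vdim_image:
  assumes "W \<in> vsub n" "U \<subseteq> W"
  shows "vdim n W = vdim m (\<psi> ` W) + vdim n U"
  using vdim_vimage[OF image_vsub[OF assms(1)]] vimage_image[OF assms] by simp

text \<open>The correspondence theorem: image and preimage under \<open>\<psi>\<close> are mutually
  inverse between subspaces above \<open>U\<close> and subspaces of the quotient, shifting
  dimensions by \<open>vdim n U\<close>.\<close>

lemma card_above_kernel:
  assumes "vdim n U \<le> r"
  shows "card {W \<in> grassmannian n r. U \<subseteq> W} = gaussian_binomial TYPE('a) m (r - vdim n U)"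
proof -
  have "bij_betw ((`) \<psi>) {W \<in> grassmannian n r. U \<subseteq> W} (grassmannian m (r - vdim n U))"
  proof (rule bij_betwI[where g = "\<lambda>V. \<psi> -` V \<inter> carrier_vec n"])
    show "(`) \<psi> \<in> {W \<in> grassmannian n r. U \<subseteq> W} \<rightarrow> grassmannian m (r - vdim n U)"
    proof
      fix W assume "W \<in> {W \<in> grassmannian n r. U \<subseteq> W}"
      then have W: "W \<in> vsub n" "U \<subseteq> W" "vdim n W = r" by (auto simp: grassmannian_def)
      then show "\<psi> ` W \<in> grassmannian m (r - vdim n U)"
        using image_vsub[OF W(1)] vdim_image[OF W(1,2)] by (simp add: grassmannian_def)
    qed
    show "(\<lambda>V. \<psi> -` V \<inter> carrier_vec n) \<in> grassmannian m (r - vdim n U) \<rightarrow> {W \<in> grassmannian n r. U \<subseteq> W}"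
    proof
      fix V :: "'a vec set" assume "V \<in> grassmannian m (r - vdim n U)"
      then have V: "V \<in> vsub m" "vdim m V = r - vdim n U" by (auto simp: grassmannian_def)
      then show "\<psi> -` V \<inter> carrier_vec n \<in> {W \<in> grassmannian n r. U \<subseteq> W}"
        using vimage_vsub[OF V(1)] vdim_vimage[OF V(1)] kernel_subset_vimage[OF V(1)] assms
        by (simp add: grassmannian_def)
    qed
    show "\<psi> -` (\<psi> ` W) \<inter> carrier_vec n = W" if "W \<in> {W \<in> grassmannian n r. U \<subseteq> W}" for W
      using that by (intro vimage_image) (auto simp: grassmannian_def)
    show "\<psi> ` (\<psi> -` V \<inter> carrier_vec n) = V" if "V \<in> grassmannian m (r - vdim n U)" for V
      using that by (intro image_vimage vsubD(1)) (simp add: grassmannian_def)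
  qed
  then show ?thesis by (simp add: bij_betw_same_card card_grassmannian[symmetric])
qed

end

text \<open>\<open>\<psi>\<close> is the projection to cosets followed by the isomorphism that
  closure under contraction supplies. It depends on \<open>U\<close> only and serves all members of
  \<open>X\<close> at once; it exists even if \<open>X\<close> has no member on the space.\<close>

lemma contraction_vec_quotient:
  fixes X :: "('a::{field,finite}, 'a vec) qmat set"
  assumes "closed_under_contraction X" and U: "U \<in> vsub n" and dim: "vdim n U = u" and "u \<le> n"
  obtains \<psi> where "vec_quotient n (n - u) U \<psi>"
    and "\<forall>\<rho>. (module_vec TYPE('a) n, \<rho>) \<in> X \<longrightarrow>
      (module_vec TYPE('a) (n - u), \<lambda>V\<in>vsub (n - u). \<rho> (\<psi> -` V \<inter> carrier_vec n) - \<rho> U) \<in> X"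
proof -
  interpret vec_space "TYPE('a)" n .
  have U': "VectorSpace.subspace class_ring U V" using U by (simp add: subspaces_def)
  interpret U: abelian_subgroup U V by (rule subspace_abelian_subgroup[OF U'])
  let ?Q = "quotient_space V U" and ?W = "module_vec TYPE('a) (n - u)"
  obtain \<phi> where \<phi>: "vs_isomorphism class_ring ?Q ?W \<phi>"
    and X: "\<And>M. M \<in> members_on X n \<Longrightarrow>
      q_matroid_image class_ring \<phi> ?W (contraction class_ring M U) \<in> members_on X (n - u)"
    using assms unfolding closed_under_contraction_def by blast
  interpret \<phi>: linear_map class_ring ?Q ?W \<phi> using \<phi> by (simp add: vs_isomorphism_def)
  have bij: "bij_betw \<phi> (carrier ?Q) (carrier_vec (n - u))"
    using \<phi> by (simp add: vs_isomorphism_def module_vec_simps)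
  define \<pi> where "\<pi> v = U +>\<^bsub>V\<^esub> v" for v
  define \<psi> where "\<psi> v = \<phi> (\<pi> v)" for v
  have carrier_Q: "carrier ?Q = \<pi> ` carrier_vec n"
    by (auto simp: quotient_space_def A_RCOSETS_def' \<pi>_def module_vec_simps)
  have \<pi>_add: "\<pi> (v + w) = \<pi> v \<oplus>\<^bsub>?Q\<^esub> \<pi> w" if "v \<in> carrier_vec n" "w \<in> carrier_vec n" for v w
    using U.a_rcos_sum[of v w] that by (simp add: quotient_space_def \<pi>_def module_vec_simps)
  have \<pi>_smult: "\<pi> (c \<cdot>\<^sub>v v) = c \<odot>\<^bsub>?Q\<^esub> \<pi> v" if "v \<in> carrier_vec n" for c v
    using quotient_space_smult[OF U', of c v] that by (simp add: \<pi>_def module_vec_simps)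
  have zero_Q: "\<zero>\<^bsub>?Q\<^esub> = U" by (simp add: quotient_space_def)
  have \<pi>_self: "v \<in> \<pi> v" if "v \<in> carrier_vec n" for v
    using U.a_rcos_self[of v] that by (simp add: \<pi>_def module_vec_simps)
  have \<pi>_eq: "\<pi> w = \<pi> v" if "w \<in> \<pi> v" "v \<in> carrier_vec n" for v w
    using U.a_repr_independence'[of w v] that by (simp add: \<pi>_def module_vec_simps)
  have \<pi>_sub: "\<pi> v \<subseteq> carrier_vec n" if "v \<in> carrier_vec n" for v
    using M.a_r_coset_subset_G[of U v] vsubD(1)[OF U] that by (simp add: \<pi>_def module_vec_simps)
  have "\<pi> (0\<^sub>v n) = (\<lambda>h. h + 0\<^sub>v n) ` U" by (auto simp: \<pi>_def a_r_coset_def' module_vec_simps)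
  also have "\<dots> = id ` U" by (rule image_cong) (use vsubD(2)[OF U] in auto)
  finally have \<pi>0: "\<pi> (0\<^sub>v n) = U" by simp
  have \<pi>_U: "\<pi> v = U \<longleftrightarrow> v \<in> U" if "v \<in> carrier_vec n" for v
    using \<pi>_self[OF that] \<pi>_eq[of v "0\<^sub>v n"] \<pi>0 by auto
  have \<phi>0: "\<phi> x = 0\<^sub>v (n - u) \<longleftrightarrow> x = U" if "x \<in> carrier ?Q" for x
  proof -
    have "\<phi> U = 0\<^sub>v (n - u)" using \<phi>.f0_is_0 zero_Q by (simp add: module_vec_simps)
    moreover have "U \<in> carrier ?Q" unfolding carrier_Q
      by (intro image_eqI[of _ _ "0\<^sub>v n"]) (simp_all add: \<pi>0)
    ultimately show ?thesis using bij_betw_imp_inj_on[OF bij] that by (metis inj_onD)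
  qed
  have "vec_quotient n (n - u) U \<psi>"
  proof
    show "\<psi> v \<in> carrier_vec (n - u)" if "v \<in> carrier_vec n" for v
      using bij_betw_apply[OF bij] that by (auto simp: \<psi>_def carrier_Q)
    show "\<psi> (v + w) = \<psi> v + \<psi> w" if "v \<in> carrier_vec n" "w \<in> carrier_vec n" for v w
      using \<phi>.f_add[of "\<pi> v" "\<pi> w"] that \<pi>_add[OF that]
      by (auto simp: \<psi>_def carrier_Q module_vec_simps)
    show "\<psi> (c \<cdot>\<^sub>v v) = c \<cdot>\<^sub>v \<psi> v" if "v \<in> carrier_vec n" for c v
      using \<phi>.f_smult[of c "\<pi> v"] that \<pi>_smult[OF that, of c]
      by (auto simp: \<psi>_def carrier_Q module_vec_simps)
    show "\<psi> ` carrier_vec n = carrier_vec (n - u)"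
      using bij_betw_imp_surj_on[OF bij] by (simp add: carrier_Q \<psi>_def image_image)
    show "{v \<in> carrier_vec n. \<psi> v = 0\<^sub>v (n - u)} = U"
      using \<phi>0 \<pi>_U vsubD(2)[OF U] by (auto simp: \<psi>_def carrier_Q)
  qed
  moreover have "\<forall>\<rho>. (V, \<rho>) \<in> X \<longrightarrow>
      (?W, \<lambda>S\<in>vsub (n - u). \<rho> (\<psi> -` S \<inter> carrier_vec n) - \<rho> U) \<in> X"
  proof (intro allI impI)
    fix \<rho> assume \<rho>: "(V, \<rho>) \<in> X"
    interpret vec_quotient n "n - u" U \<psi> by fact
    \<comment> \<open>\<open>contraction\<close> evaluates \<open>\<rho>\<close> at the union of a
      set of cosets; here that union becomes a preimage under \<open>\<psi>\<close>.\<close>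
    have union: "\<Union>(\<phi> -` S \<inter> carrier ?Q) = \<psi> -` S \<inter> carrier_vec n" for S
    proof (intro equalityI subsetI)
      fix x assume "x \<in> \<Union>(\<phi> -` S \<inter> carrier ?Q)"
      then obtain v where v: "v \<in> carrier_vec n" "\<phi> (\<pi> v) \<in> S" "x \<in> \<pi> v" by (auto simp: carrier_Q)
      then show "x \<in> \<psi> -` S \<inter> carrier_vec n" using \<pi>_sub[OF v(1)] \<pi>_eq[OF v(3,1)] by (auto simp: \<psi>_def)
    next
      fix x assume x: "x \<in> \<psi> -` S \<inter> carrier_vec n"
      show "x \<in> \<Union>(\<phi> -` S \<inter> carrier ?Q)"
        by (rule UnionI[of "\<pi> x"]) (use x \<pi>_self in \<open>auto simp: carrier_Q \<psi>_def\<close>)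
    qed
    \<comment> \<open>The contracted rank function is restricted to subspaces of the quotient, so
      its argument must be shown to be one.\<close>
    have sub: "\<phi> -` S \<inter> carrier ?Q \<in> subspaces class_ring ?Q" if "S \<in> vsub (n - u)" for S
    proof -
      have "submodule class_ring (\<phi> -` S \<inter> carrier ?Q) ?Q"
      proof (rule submodule.intro)
        show "Module.module class_ring ?Q"
          using quotient_space_vectorspace[OF U'] by (simp add: vectorspace_def)
        show "\<zero>\<^bsub>?Q\<^esub> \<in> \<phi> -` S \<inter> carrier ?Q"
          using \<phi>.f0_is_0 vsubD(3)[OF that] by (simp add: module_vec_simps)
        show "v \<oplus>\<^bsub>?Q\<^esub> w \<in> \<phi> -` S \<inter> carrier ?Q"
          if "v \<in> \<phi> -` S \<inter> carrier ?Q" "w \<in> \<phi> -` S \<inter> carrier ?Q" for v w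
          using that vsubD(4)[OF \<open>S \<in> vsub (n - u)\<close>] by (simp add: module_vec_simps)
        show "c \<odot>\<^bsub>?Q\<^esub> v \<in> \<phi> -` S \<inter> carrier ?Q"
          if "c \<in> carrier class_ring" "v \<in> \<phi> -` S \<inter> carrier ?Q" for c v
          using that vsubD(5)[OF \<open>S \<in> vsub (n - u)\<close>] by (simp add: module_vec_simps)
      qed auto
      then show ?thesis
        using quotient_space_vectorspace[OF U'] by (simp add: subspaces_def VectorSpace.subspace_def)
    qed
    have "q_matroid_image class_ring \<phi> ?W (contraction class_ring (V, \<rho>) U)
        = (?W, \<lambda>S\<in>vsub (n - u). \<rho> (\<psi> -` S \<inter> carrier_vec n) - \<rho> U)"
      using sub union by (auto simp: q_matroid_image_def contraction_def fun_eq_iff restrict_def)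
    moreover have "(V, \<rho>) \<in> members_on X n" using \<rho> by (simp add: members_on_def)
    ultimately show "(?W, \<lambda>S\<in>vsub (n - u). \<rho> (\<psi> -` S \<inter> carrier_vec n) - \<rho> U) \<in> X"
      using X[of "(V, \<rho>)"] by (simp add: members_on_def)
  qed
  ultimately show thesis by (rule that)
qed

section \<open>Counting families of bases and their traces\<close>

definition rank_functions :: "('a::{field,finite}, 'a vec) qmat set \<Rightarrow> nat \<Rightarrow> nat \<Rightarrow> ('a vec set \<Rightarrow> nat) set" where
  "rank_functions X r n = {\<rho>. (module_vec TYPE('a) n, \<rho>) \<in> X \<and> \<rho> (carrier_vec n) = r}"

lemma card_members_of_rank: "card (members_of_rank X r n) = card (rank_functions X r n)"
  for X :: "('a::{field,finite}, 'a vec) qmat set"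
proof -
  have "members_of_rank X r n = Pair (module_vec TYPE('a) n) ` rank_functions X r n"
    by (auto simp: members_of_rank_def members_on_def rank_functions_def module_vec_simps)
  then show ?thesis by (simp add: card_image inj_on_def)
qed

lemma rank_functions_q_matroid:
  "class_of_q_matroids X \<Longrightarrow> \<rho> \<in> rank_functions X r n \<Longrightarrow> q_matroid_on n \<rho>"
  by (auto simp: class_of_q_matroids_def rank_functions_def)

text \<open>Rank functions are extensional on finitely many subspaces with values at most
  \<open>n\<close>. Finiteness keeps \<open>card\<close> from defaulting to 0 in the
  estimates.\<close>

lemma finite_rank_functions:
  fixes X :: "('a::{field,finite}, 'a vec) qmat set"
  assumes X: "class_of_q_matroids X"
  shows "finite (rank_functions X r n)"
proof (rule finite_subset)
  show "finite (vsub n \<rightarrow>\<^sub>E {..n} :: ('a vec set \<Rightarrow> nat) set)" by (intro finite_PiE finite_vsub) auto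
  show "rank_functions X r n \<subseteq> vsub n \<rightarrow>\<^sub>E {..n}"
  proof
    fix \<rho> assume "\<rho> \<in> rank_functions X r n"
    then interpret q_matroid class_ring "module_vec TYPE('a) n" \<rho> by (rule rank_functions_q_matroid[OF X])
    have "\<rho> V \<le> n" if "V \<in> vsub n" for V
      using rank_le_dim[OF that] vdim_mono[OF that carrier_vsub vsubD(1)[OF that]]
      by (simp add: vdim_carrier)
    then show "\<rho> \<in> vsub n \<rightarrow>\<^sub>E {..n}" using extensional by (auto simp: PiE_def)
  qed
qed

text \<open>If \<open>U\<close> is independent, the bases above \<open>U\<close> correspond to the
  bases of the contraction by \<open>U\<close>, so the trace is a function of the contracted rank
  function. If \<open>U\<close> is dependent no basis contains it. The summand 1 pays for the empty
  trace, which is also the trace of the added empty family.\<close>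

lemma card_q_bases_traces_le:
  fixes X :: "('a::{field,finite}, 'a vec) qmat set"
  assumes X: "class_of_q_matroids X" "closed_under_contraction X"
    and U: "U \<in> grassmannian n u" and ur: "u \<le> r" "r \<le> n"
  shows "card ((\<lambda>\<B>. \<B> \<inter> {W. U \<subseteq> W}) ` insert {} (q_bases n r ` rank_functions X r n))
    \<le> card (rank_functions X (r - u) (n - u)) + 1"
proof -
  have U': "U \<in> vsub n" "vdim n U = u" using U by (auto simp: grassmannian_def)
  obtain \<psi> where "vec_quotient n (n - u) U \<psi>"
    and contr: "\<forall>\<rho>. (module_vec TYPE('a) n, \<rho>) \<in> X \<longrightarrow>
      (module_vec TYPE('a) (n - u), \<lambda>V\<in>vsub (n - u). \<rho> (\<psi> -` V \<inter> carrier_vec n) - \<rho> U) \<in> X"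
    using contraction_vec_quotient[OF X(2) U' order_trans[OF ur]] .
  then interpret vec_quotient n "n - u" U \<psi> by simp
  \<comment> \<open>\<open>g\<close> rebuilds a trace from a rank function on the quotient.\<close>
  define g where "g \<rho>' = {W \<in> grassmannian n r. U \<subseteq> W \<and> \<rho>' (\<psi> ` W) = r - u}" for \<rho>'
  have "q_bases n r \<rho> \<inter> {W. U \<subseteq> W} \<in> insert {} (g ` rank_functions X (r - u) (n - u))"
    if "\<rho> \<in> rank_functions X r n" for \<rho>
  proof -
    have M: "q_matroid_on n \<rho>" using rank_functions_q_matroid[OF X(1) that] .
    interpret q_matroid class_ring "module_vec TYPE('a) n" \<rho> by (rule M)
    have \<rho>: "(module_vec TYPE('a) n, \<rho>) \<in> X" "\<rho> (carrier_vec n) = r"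
      using that by (auto simp: rank_functions_def)
    show ?thesis
    proof (cases "\<rho> U = u")
      case False
      have "\<not> U \<subseteq> W" if "W \<in> q_bases n r \<rho>" for W
      proof
        assume "U \<subseteq> W"
        moreover have "W \<in> vsub n" "\<rho> W = vdim n W" using that by (auto simp: q_bases_def grassmannian_def)
        ultimately have "\<rho> U = vdim n U" by (intro subspace_of_independent[OF M U'(1)])
        then show False using False U'(2) by simp
      qed
      then show ?thesis by blast
    next
      case True
      define \<sigma> where "\<sigma> = (\<lambda>V\<in>vsub (n - u). \<rho> (\<psi> -` V \<inter> carrier_vec n) - \<rho> U)"
      have "\<psi> -` carrier_vec (n - u) \<inter> carrier_vec n = carrier_vec n" using closed by auto
      then have "\<sigma> \<in> rank_functions X (r - u) (n - u)"
        using contr[rule_format, OF \<rho>(1)] \<rho>(2) True by (simp add: rank_functions_def carrier_vsub \<sigma>_def)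
      moreover have "\<sigma> (\<psi> ` W) = r - u \<longleftrightarrow> \<rho> W = r" if W: "W \<in> grassmannian n r" "U \<subseteq> W" for W
      proof -
        have W': "W \<in> vsub n" using W by (simp add: grassmannian_def)
        have "\<sigma> (\<psi> ` W) = \<rho> W - u" using image_vsub[OF W'] vimage_image[OF W' W(2)] True by (simp add: \<sigma>_def)
        \<comment> \<open>Since \<open>u \<le> r\<close> and
          \<open>u = \<rho> U \<le> \<rho> W\<close>, neither subtraction truncates and
          \<open>u\<close> cancels.\<close>
        then show ?thesis using rank_mono[OF U'(1) W' W(2)] True ur by auto
      qed
      then have "q_bases n r \<rho> \<inter> {W. U \<subseteq> W} = g \<sigma>" unfolding q_bases_def g_def by blast
      ultimately show ?thesis by blast
    qed
  qed
  then have "(\<lambda>\<B>. \<B> \<inter> {W. U \<subseteq> W}) ` insert {} (q_bases n r ` rank_functions X r n)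
      \<subseteq> insert {} (g ` rank_functions X (r - u) (n - u))" by auto
  then have "card ((\<lambda>\<B>. \<B> \<inter> {W. U \<subseteq> W}) ` insert {} (q_bases n r ` rank_functions X r n))
      \<le> card (insert {} (g ` rank_functions X (r - u) (n - u)))"
    by (intro card_mono) (auto simp: finite_rank_functions[OF X(1)])
  also have "\<dots> \<le> Suc (card (g ` rank_functions X (r - u) (n - u)))" by (rule card_insert_le_m1) auto
  also have "\<dots> \<le> card (rank_functions X (r - u) (n - u)) + 1"
    using card_image_le[OF finite_rank_functions[OF X(1)]] by simp
  finally show ?thesis .
qed

text \<open>Bases determine the rank function, and no q-matroid has an empty family of bases, so the
  added empty family is new.\<close>

lemma card_bases_families:
  fixes X :: "('a::{field,finite}, 'a vec) qmat set"
  assumes X: "class_of_q_matroids X"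
  shows "card (insert {} (q_bases n r ` rank_functions X r n)) = card (rank_functions X r n) + 1"
proof -
  have r: "\<rho> (carrier_vec n) = r" if "\<rho> \<in> rank_functions X r n" for \<rho>
    using that by (simp add: rank_functions_def)
  have "inj_on (q_bases n r) (rank_functions X r n)"
    by (rule inj_onI) (rule q_bases_inj[OF rank_functions_q_matroid[OF X] rank_functions_q_matroid[OF X] r r])
  moreover have "{} \<notin> q_bases n r ` rank_functions X r n"
  proof
    assume "{} \<in> q_bases n r ` rank_functions X r n"
    then obtain \<rho> where \<rho>: "\<rho> \<in> rank_functions X r n" "q_bases n r \<rho> = {}" by auto
    then show False using q_bases_nonempty[OF rank_functions_q_matroid[OF X \<rho>(1)] r[OF \<rho>(1)]] by simp
  qed
  ultimately show ?thesis by (simp add: finite_rank_functions[OF X] card_image)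
qed

section \<open>Double counting and the inequality\<close>

text \<open>Pairs \<open>U \<subseteq> W\<close> of dimensions \<open>u\<close> and \<open>r\<close>
  are counted from \<open>W\<close> and from \<open>U\<close>. The count above \<open>U\<close> runs
  through a quotient map, whose existence is a hypothesis here and comes from closure under
  contraction later.\<close>

lemma gaussian_binomial_mult:
  assumes "u \<le> r" "r \<le> n"
    and "\<And>U :: 'a vec set. U \<in> grassmannian n u \<Longrightarrow> \<exists>\<psi>. vec_quotient n (n - u) U \<psi>"
  shows "gaussian_binomial TYPE('a::{field,finite}) n r * gaussian_binomial TYPE('a) r u
    = gaussian_binomial TYPE('a) n u * gaussian_binomial TYPE('a) (n - u) (r - u)"
proof -
  have "(\<Sum>W\<in>(grassmannian n r :: 'a vec set set). card {U \<in> grassmannian n u. U \<subseteq> W})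
      = (\<Sum>U\<in>(grassmannian n u :: 'a vec set set). card {W \<in> grassmannian n r. U \<subseteq> W})"
    unfolding card_eq_sum by (intro sum.swap_restrict finite_grassmannian)
  moreover have "card {U \<in> grassmannian n u. U \<subseteq> W} = gaussian_binomial TYPE('a) r u"
    if "W \<in> grassmannian n r" for W :: "'a vec set"
    using that card_subspaces_below[of W n u] by (simp add: grassmannian_def)
  moreover have "card {W \<in> grassmannian n r. U \<subseteq> W} = gaussian_binomial TYPE('a) (n - u) (r - u)"
    if U: "U \<in> grassmannian n u" for U :: "'a vec set"
  proof -
    obtain \<psi> where "vec_quotient n (n - u) U \<psi>" using assms(3)[OF U] by blast
    then show ?thesis
      using vec_quotient.card_above_kernel[of n "n - u" U \<psi> r] U assms(1) by (simp add: grassmannian_def)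
  qed
  ultimately show ?thesis by (simp add: card_grassmannian)
qed

theorem theorem25:
  fixes X :: "('a::{field,finite}, 'a vec) qmat set"
    and u r n :: nat
    and b :: real
  assumes "class_of_q_matroids X"
    and "closed_under_contraction X"
    and "b > 1"
    and "u \<le> r" and "r \<le> n"
  shows "log b (real (card (members_of_rank X r n)) + 1) / real (gaussian_binomial TYPE('a) n r)
      \<le> log b (real (card (members_of_rank X (r - u) (n - u))) + 1)
          / real (gaussian_binomial TYPE('a) (n - u) (r - u))"
proof -
  define x x' where "x = card (rank_functions X r n)" and "x' = card (rank_functions X (r - u) (n - u))"
  define k where "k = gaussian_binomial TYPE('a) r u"
  define F where "F = insert {} (q_bases n r ` rank_functions X r n)"
  have k: "k > 0" unfolding k_def by (rule gaussian_binomial_pos[OF assms(4)])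
  have quot: "\<exists>\<psi>. vec_quotient n (n - u) U \<psi>" if "U \<in> grassmannian n u" for U :: "'a vec set"
  proof -
    have "U \<in> vsub n" "vdim n U = u" using that by (auto simp: grassmannian_def)
    then show ?thesis
      by (rule contraction_vec_quotient[OF assms(2) _ _ order_trans[OF assms(4,5)]]) (rule exI)
  qed
  \<comment> \<open>Shearer with ground set \<open>grassmannian n r\<close> and index set
    \<open>grassmannian n u\<close>; each \<open>W\<close> is covered once for every
    \<open>u\<close>-dimensional subspace of it, that is \<open>k\<close> times.\<close>
  have "card F ^ k \<le> (\<Prod>U\<in>(grassmannian n u :: 'a vec set set). card ((\<lambda>\<B>. \<B> \<inter> {W. U \<subseteq> W}) ` F))"
  proof (rule shearer_counting)
    show "card {U \<in> grassmannian n u. W \<in> {W. U \<subseteq> W}} = k" if "W \<in> grassmannian n r" for W :: "'a vec set"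
      using card_subspaces_below[of W n u] that by (simp add: grassmannian_def k_def)
    show "F \<subseteq> Pow (grassmannian n r)" by (auto simp: F_def q_bases_def)
  qed (use k in \<open>auto simp: finite_grassmannian\<close>)
  also have "\<dots> \<le> (\<Prod>U\<in>(grassmannian n u :: 'a vec set set). x' + 1)"
    unfolding F_def x'_def by (intro prod_mono conjI card_q_bases_traces_le assms) auto
  finally have "(x + 1) ^ k \<le> (x' + 1) ^ gaussian_binomial TYPE('a) n u"
    by (simp add: F_def card_bases_families[OF assms(1)] x_def card_grassmannian)
  then have "real ((x + 1) ^ k) \<le> real ((x' + 1) ^ gaussian_binomial TYPE('a) n u)" by (rule of_nat_mono)
  then have "log b (real ((x + 1) ^ k)) \<le> log b (real ((x' + 1) ^ gaussian_binomial TYPE('a) n u))"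
    using assms(3) by (subst log_le_cancel_iff) auto
  then have le: "k * log b (real x + 1) \<le> gaussian_binomial TYPE('a) n u * log b (real x' + 1)"
    by (simp add: log_nat_power add.commute)
  have "real (gaussian_binomial TYPE('a) n r) * k
      = real (gaussian_binomial TYPE('a) n u) * gaussian_binomial TYPE('a) (n - u) (r - u)"
    unfolding k_def using gaussian_binomial_mult[OF assms(4,5) quot] by (simp flip: of_nat_mult)
  \<comment> \<open>The fraction is expanded by \<open>k\<close> so that the denominator becomes the
    number of pairs \<open>U \<subseteq> W\<close>, which the preceding identity rewrites.\<close>
  moreover have "log b (real x + 1) / gaussian_binomial TYPE('a) n r
      = k * log b (real x + 1) / (real (gaussian_binomial TYPE('a) n r) * k)"
    using k by simp
  ultimately have "log b (real x + 1) / gaussian_binomial TYPE('a) n r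
      = k * log b (real x + 1) / (real (gaussian_binomial TYPE('a) n u) * gaussian_binomial TYPE('a) (n - u) (r - u))"
    by simp
  also have "\<dots> \<le> gaussian_binomial TYPE('a) n u * log b (real x' + 1)
      / (real (gaussian_binomial TYPE('a) n u) * gaussian_binomial TYPE('a) (n - u) (r - u))"
    using le by (rule divide_right_mono) simp
  \<comment> \<open>The number of \<open>u\<close>-dimensional subspaces is positive and
    cancels.\<close>
  also have "\<dots> = log b (real x' + 1) / gaussian_binomial TYPE('a) (n - u) (r - u)"
    using gaussian_binomial_pos[of u n, where 'a = 'a] assms(4,5) by simp
  finally show ?thesis by (simp add: card_members_of_rank x_def x'_def)
qed

end
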